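(* There is a constant $C>0$ such that the following holds. If a function $\theta$ on $\mathbb{R}^3$ has a modulus of continuity $\omega$, then $$v=\big(R_1R_3\theta,\ R_2R_3\theta,\ -R_1^2\theta-R_2^2\theta\big)$$ has modulus of continuity $$\Omega(\xi)=C\bigg(\int_0^\xi\frac{\omega(s)}{s}\log\Big(\frac{e\,\xi}{s}\Big)\,ds+\xi\int_\xi^\infty\frac{\omega(s)}{s^2}\log\Big(\frac{e\,s}{\xi}\Big)\,ds\bigg).$$
   Context: A modulus of continuity is an increasing continuous concave function $\omega:[0,+\infty)\to[0,+\infty)$ with $\omega(0)=0$. A function $f:\mathbb{R}^n\to\mathbb{R}^m$ has modulus of continuity $\omega$ if $|f(x)-f(y)|\le\omega(|x-y|)$ for all $x,y\in\mathbb{R}^n$. $R_j$ denotes the $j$-th Riesz transform on $\mathbb{R}^3$, and $e$ is Euler's number. *)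

theory Defs
  imports "HOL-Analysis.Analysis"
begin

text \<open>Moduli of continuity are total functions on the reals of which only the restriction to
  \<open>[0, \<infinity>)\<close> matters. Increasing is read as nondecreasing, so that bounded moduli such as
  \<open>min s 1\<close> are allowed.\<close>

definition modulus_of_continuity :: "(real \<Rightarrow> real) \<Rightarrow> bool" where
  "modulus_of_continuity w \<longleftrightarrow>
     (\<forall>s\<ge>0. 0 \<le> w s) \<and> w 0 = 0 \<and> mono_on {0..} w \<and> continuous_on {0..} w \<and> concave_on {0..} w"

text \<open>The bound is extended-valued because the integrals defining \<open>Omega\<close> below may diverge.\<close>

definition has_modulus ::
  "('a::real_normed_vector \<Rightarrow> 'b::real_normed_vector) \<Rightarrow> (real \<Rightarrow> ennreal) \<Rightarrow> bool" where
  "has_modulus f w \<longleftrightarrow> (\<forall>x y. ennreal (norm (f x - f y)) \<le> w (norm (x - y)))"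

text \<open>The normalising constant of the Riesz kernel \<open>z\<^sub>j / norm z ^ (n + 1)\<close> is
  \<open>Gamma ((n + 1) / 2) / pi powr ((n + 1) / 2)\<close>, which is \<open>1 / pi\<^sup>2\<close> for \<open>n = 3\<close>.\<close>

definition riesz_kernel :: "3 \<Rightarrow> real^3 \<Rightarrow> real" where
  "riesz_kernel j z = z $ j / (pi\<^sup>2 * norm z ^ 4)"

text \<open>If \<open>f\<close> decays in the following sense (for instance if \<open>f\<close> lies in some \<open>L\<^sup>p\<close> with
  \<open>1 \<le> p < \<infinity>\<close>), the principal value integral of \<open>riesz_kernel j (x - y) * f y\<close> needs no
  correction at infinity. A function that merely has a modulus of continuity may be unbounded, and
  then that integral can diverge at infinity. As usual for bounded or BMO functions, one then
  subtracts \<open>riesz_kernel j (- y) * f y\<close> over \<open>norm y > 1\<close>: this contribution does not depend on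
  \<open>x\<close>, so whenever it converges it changes the transform by an additive constant only.\<close>

definition tail_integrable :: "(real^3 \<Rightarrow> real) \<Rightarrow> bool" where
  "tail_integrable f \<longleftrightarrow> set_integrable lebesgue {y. 1 < norm y} (\<lambda>y. f y / norm y ^ 3)"

definition riesz_integrand :: "3 \<Rightarrow> (real^3 \<Rightarrow> real) \<Rightarrow> real^3 \<Rightarrow> real^3 \<Rightarrow> real" where
  "riesz_integrand j f x y =
     (riesz_kernel j (x - y)
        - (if tail_integrable f \<or> norm y \<le> 1 then 0 else riesz_kernel j (- y))) * f y"

definition riesz_trunc :: "3 \<Rightarrow> (real^3 \<Rightarrow> real) \<Rightarrow> real \<Rightarrow> real^3 \<Rightarrow> real" where
  "riesz_trunc j f \<epsilon> x = (LINT y:{y. \<epsilon> < norm (x - y)}|lebesgue. riesz_integrand j f x y)"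

definition riesz :: "3 \<Rightarrow> (real^3 \<Rightarrow> real) \<Rightarrow> real^3 \<Rightarrow> real" where
  "riesz j f x = Lim (at_right 0) (\<lambda>\<epsilon>. riesz_trunc j f \<epsilon> x)"

text \<open>The value of \<open>riesz j f\<close> is meaningful only if the truncated integrals exist and converge
  at every point.\<close>

definition riesz_exists :: "3 \<Rightarrow> (real^3 \<Rightarrow> real) \<Rightarrow> bool" where
  "riesz_exists j f \<longleftrightarrow> (\<forall>x.
     (\<forall>\<epsilon>>0. set_integrable lebesgue {y. \<epsilon> < norm (x - y)} (riesz_integrand j f x)) \<and>
     (\<exists>l. ((\<lambda>\<epsilon>. riesz_trunc j f \<epsilon> x) \<longlongrightarrow> l) (at_right 0)))"

definition velocity :: "(real^3 \<Rightarrow> real) \<Rightarrow> real^3 \<Rightarrow> real^3" where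
  "velocity \<theta> x = vector
     [riesz 1 (riesz 3 \<theta>) x,
      riesz 2 (riesz 3 \<theta>) x,
      - riesz 1 (riesz 1 \<theta>) x - riesz 2 (riesz 2 \<theta>) x]"

definition velocity_exists :: "(real^3 \<Rightarrow> real) \<Rightarrow> bool" where
  "velocity_exists \<theta> \<longleftrightarrow>
     riesz_exists 1 \<theta> \<and> riesz_exists 2 \<theta> \<and> riesz_exists 3 \<theta> \<and>
     riesz_exists 1 (riesz 3 \<theta>) \<and> riesz_exists 2 (riesz 3 \<theta>) \<and>
     riesz_exists 1 (riesz 1 \<theta>) \<and> riesz_exists 2 (riesz 2 \<theta>)"

text \<open>For \<open>s\<close>, \<open>\<xi>\<close> in the ranges of integration both logarithms are at least \<open>1\<close>, so no negative
  part is lost by the coercion to \<open>ennreal\<close>.\<close>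

definition Omega :: "real \<Rightarrow> (real \<Rightarrow> real) \<Rightarrow> real \<Rightarrow> ennreal" where
  "Omega C w \<xi> = ennreal C *
     ((\<integral>\<^sup>+s\<in>{0<..<\<xi>}. ennreal (w s / s * ln (exp 1 * \<xi> / s)) \<partial>lborel)
      + ennreal \<xi> * (\<integral>\<^sup>+s\<in>{\<xi><..}. ennreal (w s / s\<^sup>2 * ln (exp 1 * s / \<xi>)) \<partial>lborel))"

end

theory Submission
  imports Defs
begin

text \<open>
  Put \<open>k u = 1 / (u * max 1 u)\<close>. After the substitution \<open>s = t * \<xi>\<close>, the classical bound for the
  modulus of a singular integral, the integral of \<open>w s / s\<close> over \<open>(0, \<xi>)\<close> plus \<open>\<xi>\<close> times the
  integral of \<open>w s / s\<^sup>2\<close> over \<open>(\<xi>, \<infinity>)\<close>, is the average of \<open>w (t * \<xi>)\<close> over \<open>t > 0\<close> with weight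
  \<open>k t\<close>. In the same way \<open>Omega\<close> is, up to the factor \<open>C\<close>, the average with weight
  \<open>(1 + \<bar>ln t\<bar>) * k t\<close> (\<open>Omega_eq_dilation_average\<close>). Three facts yield the theorem.

  First, a finite average of dilates of a modulus of continuity is a modulus of continuity
  (\<open>modulus_dilation_average\<close>). By concavity such an average is finite everywhere as soon as it is
  finite at one positive argument (\<open>dilation_average_finite\<close>), so when \<open>Omega\<close> is infinite at one
  positive distance it is infinite at all of them and the claimed bound holds trivially.

  Secondly, taking the average with weight \<open>k\<close> twice amounts to averaging with the multiplicative
  convolution of \<open>k\<close> with itself, which is \<open>(2 + \<bar>ln u\<bar>) * k u\<close> (\<open>riesz_weight_convolution\<close>). This
  is where the logarithms in \<open>Omega\<close> come from.

  Thirdly, if \<open>f\<close> has modulus \<open>w\<close>, then each Riesz transform of \<open>f\<close> has as modulus a constant times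
  the average of \<open>w\<close> with weight \<open>k\<close> (\<open>riesz_increment\<close>). To compare the values at \<open>x\<close> and \<open>x'\<close>,
  let \<open>r = norm (x - x')\<close> and replace the denominator \<open>norm z ^ 4\<close> of the kernel by
  \<open>max (norm z) r ^ 4\<close>. The difference between the kernel and its capped version is odd and lives
  in the ball of radius \<open>r\<close>, so \<open>f y\<close> may be replaced by \<open>f y - f x\<close> there; this gives the part
  \<open>t < 1\<close> of the average. For the capped kernel, the difference of its translates by \<open>x\<close> and \<open>x'\<close>
  is of size \<open>r / max (norm (x - y)) r ^ 4\<close> and has integral zero
  (\<open>integral_capped_riesz_kernel_diff\<close>), so \<open>f y\<close> may again be replaced by \<open>f y - f x\<close>, and the
  whole average bounds the result. The same decomposition shows that the truncated integrals
  converge.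

  The theorem follows by applying the third fact twice and using the second one.
\<close>

section \<open>Averages of dilates of a modulus of continuity\<close>

text \<open>Substituting \<open>s = t * \<xi>\<close> turns the integrals that bound the effect of a Riesz transform
  into averages of the dilates \<open>\<xi> \<mapsto> w (t * \<xi>)\<close> against a fixed weight \<open>k\<close>. In this form every
  property of a modulus of continuity that passes to dilates and to positive combinations is
  inherited at once.\<close>

definition dilation_average :: "(real \<Rightarrow> real) \<Rightarrow> (real \<Rightarrow> real) \<Rightarrow> real \<Rightarrow> ennreal" where
  "dilation_average k w \<xi> = (\<integral>\<^sup>+t\<in>{0<..}. ennreal (k t * w (t * \<xi>)) \<partial>lborel)"

text \<open>Concavity between \<open>0\<close> and \<open>c * s\<close>, together with \<open>w 0 = 0\<close>.\<close>

lemma modulus_dilate_le: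
  assumes w: "modulus_of_continuity w" and "1 \<le> c" "0 \<le> s"
  shows "w (c * s) \<le> c * w s"
proof -
  have cc: "concave_on {0..} w" and w0: "w 0 = 0"
    using w by (auto simp: modulus_of_continuity_def)
  have "(1 - 1/c) * w 0 + (1/c) * w (c * s) \<le> w ((1 - 1/c) *\<^sub>R 0 + (1/c) *\<^sub>R (c * s))"
    using assms by (intro concave_onD[OF cc]) auto
  hence "w (c * s) / c \<le> w s"
    using assms w0 by simp
  thus ?thesis
    using assms by (simp add: divide_le_eq mult.commute)
qed

text \<open>Nothing is known about \<open>w\<close> at negative arguments. Composing with \<open>max 0\<close> gives a
  globally continuous function, which makes measurability available without restricting measures.\<close>

lemma continuous_on_modulus_max:
  assumes "modulus_of_continuity w"
  shows "continuous_on UNIV (\<lambda>t. w (max 0 t))"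
proof (rule continuous_on_compose2[where g = w and t = "{0..}" and f = "max 0"])
  show "continuous_on {0..} w"
    using assms by (simp add: modulus_of_continuity_def)
qed (auto intro!: continuous_intros)

lemma borel_measurable_modulus_max:
  assumes "modulus_of_continuity w" "g \<in> borel_measurable M"
  shows "(\<lambda>x. w (max 0 (g x))) \<in> borel_measurable M"
  using measurable_compose[OF assms(2) borel_measurable_continuous_onI[OF continuous_on_modulus_max[OF assms(1)]]]
  by simp

lemma modulus_nonneg: "modulus_of_continuity w \<Longrightarrow> 0 \<le> s \<Longrightarrow> 0 \<le> w s"
  by (simp add: modulus_of_continuity_def)

lemma modulus_mono: "modulus_of_continuity w \<Longrightarrow> 0 \<le> s \<Longrightarrow> s \<le> t \<Longrightarrow> w s \<le> w t"
  unfolding modulus_of_continuity_def by (meson atLeast_iff mono_onD order_trans)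

lemma modulus_cong:
  assumes "modulus_of_continuity v" "\<And>s. 0 \<le> s \<Longrightarrow> w s = v s"
  shows "modulus_of_continuity w"
proof -
  have "mono_on {0..} w" "concave_on {0..} w"
    using assms unfolding modulus_of_continuity_def
    by (auto simp: mono_on_def concave_on_iff)
  moreover have "continuous_on {0..} w"
    using assms unfolding modulus_of_continuity_def by (metis atLeast_iff continuous_on_cong)
  ultimately show ?thesis
    using assms unfolding modulus_of_continuity_def by auto
qed

lemma modulus_cmult:
  assumes "modulus_of_continuity w" "0 \<le> c"
  shows "modulus_of_continuity (\<lambda>s. c * w s)"
proof -
  have "concave_on {0..} (\<lambda>s. c * w s)"
    using assms unfolding modulus_of_continuity_def by (simp add: concave_on_cmul)
  thus ?thesis using assms unfolding modulus_of_continuity_def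
    by (auto simp: mono_on_def intro!: continuous_intros mult_left_mono)
qed

lemma dilation_average_max:
  assumes "0 \<le> \<xi>"
  shows "dilation_average k w \<xi> =
    (\<integral>\<^sup>+t. ennreal (indicator {0<..} t * k t * w (max 0 (t * \<xi>))) \<partial>lborel)"
  unfolding dilation_average_def
  using assms by (intro nn_integral_cong) (auto simp: indicator_def max_def mult_less_0_iff not_less
    zero_less_mult_iff dest: order.antisym)

text \<open>A dilation of the argument by \<open>c\<close> costs at most the factor \<open>max 1 c\<close>, since this holds
  for \<open>w\<close> itself. Hence an average is either finite everywhere or infinite at every positive
  argument, which is what disposes of divergent integrals.\<close>

lemma dilation_average_scale_le:
  assumes "modulus_of_continuity w" and k: "k \<in> borel_measurable borel" "\<And>t. 0 < t \<Longrightarrow> 0 \<le> k t"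
    and "0 < c" "0 \<le> \<xi>"
  shows "dilation_average k w (c * \<xi>) \<le> ennreal (max 1 c) * dilation_average k w \<xi>"
proof -
  note [measurable] = borel_measurable_modulus_max[OF assms(1)] k(1)
  have le: "w (t * (c * \<xi>)) \<le> max 1 c * w (t * \<xi>)" if "0 < t" for t
  proof (cases "c \<le> 1")
    case True
    then show ?thesis using that assms
      by (auto simp: max_def mult_left_le_one_le intro!: modulus_mono[OF assms(1)] mult_left_mono)
  next
    case False
    then show ?thesis using that assms modulus_dilate_le[OF assms(1), of c "t * \<xi>"]
      by (simp add: max_def ac_simps)
  qed
  have "dilation_average k w (c * \<xi>) \<le> (\<integral>\<^sup>+t. ennreal (max 1 c) *
      ennreal (indicator {0<..} t * k t * w (max 0 (t * \<xi>))) \<partial>lborel)"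
    unfolding dilation_average_def
  proof (rule nn_integral_mono)
    fix t :: real
    show "ennreal (k t * w (t * (c * \<xi>))) * indicator {0<..} t
        \<le> ennreal (max 1 c) * ennreal (indicator {0<..} t * k t * w (max 0 (t * \<xi>)))"
    proof (cases "0 < t")
      case True
      have "k t * w (t * (c * \<xi>)) \<le> k t * (max 1 c * w (t * \<xi>))"
        using le[OF True] k(2)[OF True] by (rule mult_left_mono)
      then show ?thesis
        using True assms by (simp add: ennreal_mult'[symmetric] ac_simps max_absorb2 ennreal_leI)
    qed auto
  qed
  also have "\<dots> = ennreal (max 1 c) * dilation_average k w \<xi>"
    unfolding dilation_average_max[OF assms(5)] 
    by (intro nn_integral_cmult) measurable
  finally show ?thesis .
qed

lemma dilation_average_finite:
  assumes "modulus_of_continuity w" "k \<in> borel_measurable borel" "\<And>t. 0 < t \<Longrightarrow> 0 \<le> k t"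
    and "0 < \<xi>" "dilation_average k w \<xi> < \<infinity>" "0 \<le> \<zeta>"
  shows "dilation_average k w \<zeta> < \<infinity>"
proof (cases "\<zeta> = 0")
  case True
  with assms(1) show ?thesis
    by (simp add: dilation_average_def modulus_of_continuity_def)
next
  case False
  have "dilation_average k w \<zeta> \<le> ennreal (max 1 (\<zeta> / \<xi>)) * dilation_average k w \<xi>"
    using dilation_average_scale_le[OF assms(1-3), of "\<zeta> / \<xi>" \<xi>] assms False by simp
  also have "\<dots> < \<infinity>"
    using assms by (simp add: ennreal_mult_less_top)
  finally show ?thesis .
qed

text \<open>Concavity and monotonicity pass through the integral pointwise in \<open>t\<close>. Continuity up to
  \<open>0\<close> follows by dominated convergence: along a convergent, hence bounded, sequence of arguments
  the integrands are dominated by the one at an upper bound.\<close>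

lemma modulus_dilation_average:
  assumes w: "modulus_of_continuity w"
    and k [measurable]: "k \<in> borel_measurable borel" and k0: "\<And>t. 0 < t \<Longrightarrow> 0 \<le> k t"
    and fin1: "dilation_average k w 1 < \<infinity>"
  shows "modulus_of_continuity (\<lambda>\<xi>. enn2real (dilation_average k w \<xi>))"
proof -
  note [measurable] = borel_measurable_modulus_max[OF w]
  \<comment> \<open>a real-valued form of the integrand, so that the Bochner integral and dominated
    convergence apply\<close>
  define h where "h \<xi> t = indicator {0<..} t * k t * w (max 0 (t * \<xi>))" for \<xi> t :: real
  have h_meas [measurable]: "h \<xi> \<in> borel_measurable borel" for \<xi>
    unfolding h_def by measurable
  have h0: "0 \<le> h \<xi> t" for \<xi> t
    using k0 modulus_nonneg[OF w] by (auto simp: h_def indicator_def)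
  have fin: "dilation_average k w \<xi> < \<infinity>" if "0 \<le> \<xi>" for \<xi>
    using dilation_average_finite[OF w k k0 _ fin1 that] by simp
  have h_int: "integrable lborel (h \<xi>)" if "0 \<le> \<xi>" for \<xi>
    using fin[OF that] h0 unfolding dilation_average_max[OF that] h_def[symmetric]
    by (intro integrableI_nonneg) auto
  have eq: "enn2real (dilation_average k w \<xi>) = integral\<^sup>L lborel (h \<xi>)" if "0 \<le> \<xi>" for \<xi>
    unfolding dilation_average_max[OF that] h_def[symmetric]
    using h0 by (subst integral_eq_nn_integral) auto
  have "modulus_of_continuity (\<lambda>\<xi>. integral\<^sup>L lborel (h \<xi>))"
    unfolding modulus_of_continuity_def
  proof (intro conjI allI impI)
    show "0 \<le> integral\<^sup>L lborel (h \<xi>)" for \<xi>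
      using h0 by simp
    show "integral\<^sup>L lborel (h 0) = 0"
      using w by (simp add: h_def[abs_def] modulus_of_continuity_def)
    have h_mono: "h \<xi> t \<le> h \<zeta> t" if "0 \<le> \<xi>" "\<xi> \<le> \<zeta>" for \<xi> \<zeta> t
      unfolding h_def using that k0 
      by (cases "0 < t") (auto intro!: mult_left_mono modulus_mono[OF w])
    show "mono_on {0..} (\<lambda>\<xi>. integral\<^sup>L lborel (h \<xi>))"
      by (intro mono_onI integral_mono h_int h_mono) auto
    show "continuous_on {0..} (\<lambda>\<xi>. integral\<^sup>L lborel (h \<xi>))"
      unfolding continuous_on_sequentially
    proof (intro allI ballI impI, elim conjE)
      fix X :: "nat \<Rightarrow> real" and a
      assume a: "a \<in> {0..}" and X0: "\<forall>n. X n \<in> {0..}" and lim: "X \<longlonglongrightarrow> a"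
      from lim have "Bseq X" by (simp add: convergentI convergent_imp_Bseq)
      then obtain M where M: "\<And>n. X n \<le> M"
        by (auto simp: Bseq_def abs_le_iff)
      have M0: "0 \<le> M" using M[of 0] X0 by (metis atLeast_iff order_trans)
      show "((\<lambda>\<xi>. integral\<^sup>L lborel (h \<xi>)) \<circ> X) \<longlonglongrightarrow> integral\<^sup>L lborel (h a)"
        unfolding comp_def
      proof (rule integral_dominated_convergence[where w = "h M"])
        have "(\<lambda>n. h (X n) t) \<longlonglongrightarrow> h a t" for t
          unfolding h_def
          by (intro tendsto_mult tendsto_const
            isCont_tendsto_compose[of _ "\<lambda>t. w (max 0 t)"] lim)
            (use continuous_on_modulus_max[OF w] in \<open>simp add: continuous_on_eq_continuous_at\<close>)
        thus "AE t in lborel. (\<lambda>n. h (X n) t) \<longlonglongrightarrow> h a t" by simp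
        show "AE t in lborel. norm (h (X n) t) \<le> h M t" for n
          using h0 h_mono[of "X n" M] M X0 by simp
      qed (use h_int M0 in auto)
    qed
    have cc: "concave_on {0..} w"
      using w by (simp add: modulus_of_continuity_def)
    show "concave_on {0..} (\<lambda>\<xi>. integral\<^sup>L lborel (h \<xi>))"
      unfolding concave_on_iff
    proof (intro conjI ballI allI impI)
      fix x y u v :: real
      assume xy: "x \<in> {0..}" "y \<in> {0..}" and uv: "0 \<le> u" "0 \<le> v" "u + v = 1"
      have pos: "0 \<le> u * x + v * y" using xy uv by auto
      have le: "u * h x t + v * h y t \<le> h (u * x + v * y) t" for t
      proof (cases "0 < t")
        case True
        have "u * w (t * x) + v * w (t * y) \<le> w (u *\<^sub>R (t * x) + v *\<^sub>R (t * y))"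
          using cc xy uv True unfolding concave_on_iff by auto
        hence "k t * (u * w (t * x) + v * w (t * y)) \<le> k t * w (t * (u * x + v * y))"
          using k0[OF True] by (intro mult_left_mono) (auto simp: algebra_simps)
        moreover have "max 0 (t * (u * x + v * y)) = t * (u * x + v * y)"
          using True pos by simp
        ultimately show ?thesis
          using True xy by (simp add: h_def distrib_left mult.left_commute)
      qed (simp add: h_def)
      have "u * integral\<^sup>L lborel (h x) + v * integral\<^sup>L lborel (h y)
          = (LINT t|lborel. u * h x t + v * h y t)"
        using h_int xy by simp
      also have "\<dots> \<le> integral\<^sup>L lborel (h (u *\<^sub>R x + v *\<^sub>R y))"
        using h_int xy pos le by (intro integral_mono) auto
      finally show "u * integral\<^sup>L lborel (h x) + v * integral\<^sup>L lborel (h y)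
          \<le> integral\<^sup>L lborel (h (u *\<^sub>R x + v *\<^sub>R y))" .
    qed auto
  qed
  thus ?thesis by (rule modulus_cong) (simp add: eq)
qed

lemma dilation_average_cmult:
  assumes v: "modulus_of_continuity v" and [measurable]: "k \<in> borel_measurable borel"
    and "0 \<le> c" "0 \<le> \<xi>"
  shows "dilation_average k (\<lambda>s. c * v s) \<xi> = ennreal c * dilation_average k v \<xi>"
proof -
  note [measurable] = borel_measurable_modulus_max[OF v]
  show ?thesis
    unfolding dilation_average_max[OF assms(4)] using assms(3)
    by (subst nn_integral_cmult[symmetric])
      (auto simp: ennreal_mult'[symmetric] ac_simps intro!: nn_integral_cong)
qed

section \<open>The weights of the Riesz transform and of its iterates\<close>

text \<open>The average of \<open>w\<close> with this weight is the integral of \<open>w s / s\<close> over \<open>(0, \<xi>)\<close> plus \<open>\<xi>\<close>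
  times the integral of \<open>w s / s\<^sup>2\<close> over \<open>(\<xi>, \<infinity>)\<close>: the modulus that a single Riesz transform
  produces.\<close>

definition riesz_weight :: "real \<Rightarrow> real" where
  "riesz_weight u = 1 / (u * max 1 u)"

text \<open>The weight that corresponds to \<open>Omega\<close> in the same way.\<close>

definition log_riesz_weight :: "real \<Rightarrow> real" where
  "log_riesz_weight u = (1 + \<bar>ln u\<bar>) * riesz_weight u"

lemma borel_measurable_riesz_weight [measurable]: "riesz_weight \<in> borel_measurable borel"
  unfolding riesz_weight_def[abs_def] by measurable

lemma borel_measurable_log_riesz_weight [measurable]: "log_riesz_weight \<in> borel_measurable borel"
  unfolding log_riesz_weight_def[abs_def] by measurable

lemma riesz_weight_nonneg: "0 < u \<Longrightarrow> 0 \<le> riesz_weight u"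
  by (simp add: riesz_weight_def)

lemma log_riesz_weight_nonneg: "0 < u \<Longrightarrow> 0 \<le> log_riesz_weight u"
  by (simp add: log_riesz_weight_def riesz_weight_nonneg)

lemma riesz_weight_le_log: "0 < u \<Longrightarrow> riesz_weight u \<le> log_riesz_weight u"
  using riesz_weight_nonneg[of u] by (simp add: log_riesz_weight_def mult_le_cancel_right1)

text \<open>This is the convolution of \<open>riesz_weight\<close> with itself on the multiplicative group of
  positive reals, which governs the composition of two averages. With \<open>m = min 1 u\<close> and
  \<open>M = max 1 u\<close> the integrand is \<open>1 / u\<^sup>2\<close> below \<open>m\<close>, \<open>riesz_weight u / t\<close> between \<open>m\<close> and \<open>M\<close>, and
  \<open>1 / (u * t\<^sup>2)\<close> above \<open>M\<close>. The outer ranges contribute \<open>riesz_weight u\<close> each, the middle one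
  contributes the logarithm.\<close>

lemma riesz_weight_convolution:
  assumes u: "0 < u"
  shows "(\<integral>\<^sup>+t\<in>{0<..}. ennreal (riesz_weight t * riesz_weight (u / t) / t) \<partial>lborel)
    = ennreal ((2 + \<bar>ln u\<bar>) * riesz_weight u)"
proof -
  define m where "m = min 1 u"
  define M where "M = max 1 u"
  have mM: "0 < m" "m \<le> M" "0 < M" "m * M = u" "ln M - ln m = \<bar>ln u\<bar>"
    using u by (auto simp: m_def M_def min_def max_def abs_if)
  have ku: "riesz_weight u = 1 / (u * M)" by (simp add: riesz_weight_def M_def)
  have pw: "ennreal (riesz_weight t * riesz_weight (u / t) / t) * indicator {0<..} t
      = ennreal (1 / u\<^sup>2) * indicator {0..m} t
        + (ennreal (riesz_weight u / t) * indicator {m..M} t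
           + ennreal (1 / (u * t\<^sup>2)) * indicator {M..} t)"
    if t: "t \<noteq> 0" "t \<noteq> m" "t \<noteq> M" for t
  proof (cases "0 < t")
    case True
    consider "t < m" | "m < t" "t < M" | "M < t" using t by fastforce
    then show ?thesis
    proof cases
      case 1
      then have "max 1 t = 1" "max 1 (u/t) = u / t"
        using True by (auto simp: m_def divide_simps)
      then have "riesz_weight t * riesz_weight (u / t) / t = 1 / u\<^sup>2"
        using True u by (simp add: riesz_weight_def field_simps power2_eq_square)
      then show ?thesis using 1 True mM by (simp add: indicator_def)
    next
      case 2
      have "riesz_weight t * riesz_weight (u / t) / t = riesz_weight u / t"
      proof (cases "1 \<le> u")
        case True
        then have "max 1 t = t" "max 1 (u/t) = u / t" "max 1 u = u"
          using 2 \<open>0 < t\<close> by (auto simp: m_def M_def divide_simps)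
        then show ?thesis
          using \<open>0 < t\<close> u by (simp add: riesz_weight_def field_simps power2_eq_square)
      next
        case False
        then have "max 1 t = 1" "max 1 (u/t) = 1" "max 1 u = 1"
          using 2 \<open>0 < t\<close> by (auto simp: m_def M_def divide_simps)
        then show ?thesis
          using \<open>0 < t\<close> u by (simp add: riesz_weight_def field_simps power2_eq_square)
      qed
      then show ?thesis using 2 True mM by (simp add: indicator_def)
    next
      case 3
      then have "max 1 t = t" "max 1 (u/t) = 1"
        using True by (auto simp: M_def divide_simps)
      then have "riesz_weight t * riesz_weight (u / t) / t = 1 / (u * t\<^sup>2)"
        using True u by (simp add: riesz_weight_def field_simps power2_eq_square)
      then show ?thesis using 3 True mM by (simp add: indicator_def)
    qed
  qed (use t mM in \<open>auto simp: indicator_def\<close>)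
  have "(\<integral>\<^sup>+t\<in>{0<..}. ennreal (riesz_weight t * riesz_weight (u / t) / t) \<partial>lborel)
      = (\<integral>\<^sup>+t. ennreal (1 / u\<^sup>2) * indicator {0..m} t
        + (ennreal (riesz_weight u / t) * indicator {m..M} t
           + ennreal (1 / (u * t\<^sup>2)) * indicator {M..} t) \<partial>lborel)"
    by (rule nn_integral_cong_AE) (use AE_lborel_singleton[of "0::real"] AE_lborel_singleton[of m]
      AE_lborel_singleton[of M] in eventually_elim, use pw in blast)
  also have "\<dots> = (\<integral>\<^sup>+t. ennreal (1 / u\<^sup>2) * indicator {0..m} t \<partial>lborel)
      + ((\<integral>\<^sup>+t. ennreal (riesz_weight u / t) * indicator {m..M} t \<partial>lborel)
      + (\<integral>\<^sup>+t. ennreal (1 / (u * t\<^sup>2)) * indicator {M..} t \<partial>lborel))"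
    by (simp add: nn_integral_add)
  also have "(\<integral>\<^sup>+t. ennreal (1 / u\<^sup>2) * indicator {0..m} t \<partial>lborel) = ennreal (riesz_weight u)"
  proof -
    have "1 / u\<^sup>2 * m = riesz_weight u"
      using mM u by (simp add: ku field_simps power2_eq_square)
    then show ?thesis
      using mM by (subst nn_integral_cmult_indicator) (auto simp: ennreal_mult''[symmetric])
  qed
  also have "(\<integral>\<^sup>+t. ennreal (riesz_weight u / t) * indicator {m..M} t \<partial>lborel)
      = ennreal (riesz_weight u * ln M - riesz_weight u * ln m)"
    using mM riesz_weight_nonneg[OF u]
    by (intro nn_integral_FTC_Icc) (auto intro!: derivative_eq_intros)
  also have "\<dots> = ennreal (riesz_weight u * \<bar>ln u\<bar>)"
    using mM by (simp add: right_diff_distrib[symmetric])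
  also have "(\<integral>\<^sup>+t. ennreal (1 / (u * t\<^sup>2)) * indicator {M..} t \<partial>lborel)
      = ennreal (0 - (- 1 / (u * M)))"
  proof (rule nn_integral_FTC_atLeast)
    show "((\<lambda>t. - 1 / (u * t)) \<longlongrightarrow> 0) at_top"
      using u by (intro tendsto_divide_0[OF tendsto_const] filterlim_at_top_imp_at_infinity
        filterlim_tendsto_pos_mult_at_top[OF tendsto_const]) (auto simp: filterlim_ident)
    show "((\<lambda>t. - 1 / (u * t)) has_real_derivative 1 / (u * t\<^sup>2)) (at t)" if "M \<le> t" for t
      using mM u that by (auto intro!: derivative_eq_intros simp: field_simps power2_eq_square)
  qed (use mM u in auto)
  also have "\<dots> = ennreal (riesz_weight u)" by (simp add: ku)
  finally show ?thesis
    using riesz_weight_nonneg[OF u] by (simp add: ennreal_plus[symmetric] algebra_simps del: ennreal_plus)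
qed

text \<open>Tonelli: after the substitution \<open>u = s * t\<close> in the inner average, the iterated average
  has the convolution of the two weights as its weight.\<close>

lemma dilation_average_riesz_riesz_le:
  assumes w: "modulus_of_continuity w" and fin: "dilation_average riesz_weight w 1 < \<infinity>"
    and "0 \<le> \<xi>"
  shows "dilation_average riesz_weight (\<lambda>s. enn2real (dilation_average riesz_weight w s)) \<xi>
    \<le> 2 * dilation_average log_riesz_weight w \<xi>"
proof -
  note [measurable] = borel_measurable_modulus_max[OF w]
  let ?k = riesz_weight and ?I = "indicator {0<..} :: real \<Rightarrow> real"
  let ?W = "\<lambda>u. w (max 0 (u * \<xi>))"
  have W0: "0 \<le> ?W u" for u by (simp add: modulus_nonneg[OF w])
  have finite: "dilation_average ?k w s < \<infinity>" if "0 \<le> s" for s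
    using dilation_average_finite[OF w borel_measurable_riesz_weight riesz_weight_nonneg _ fin that]
    by simp
  have inner: "dilation_average ?k w (t * \<xi>)
      = (\<integral>\<^sup>+u. ennreal (?I u * ?k (u / t) / t * ?W u) \<partial>lborel)" if "0 < t" for t
  proof -
    have "dilation_average ?k w (t * \<xi>)
        = ennreal \<bar>1 / t\<bar> * (\<integral>\<^sup>+u. ennreal (?I (u / t) * ?k (u / t) * w (max 0 (u / t * (t * \<xi>)))) \<partial>lborel)"
    proof -
      have tx: "0 \<le> t * \<xi>" and "1 / t \<noteq> 0" using that assms(3) by simp_all
      then show ?thesis
        unfolding dilation_average_max[OF tx]
        by (subst nn_integral_real_affine[where c = "1 / t" and t = 0]) simp_all
    qed
    also have "\<dots> = (\<integral>\<^sup>+u. ennreal \<bar>1 / t\<bar> * ennreal (?I (u / t) * ?k (u / t) * ?W u) \<partial>lborel)"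
      using that by (subst nn_integral_cmult) auto
    also have "\<dots> = (\<integral>\<^sup>+u. ennreal (?I u * ?k (u / t) / t * ?W u) \<partial>lborel)"
      using that by (intro nn_integral_cong)
        (auto simp: ennreal_mult'[symmetric] indicator_def zero_less_divide_iff)
    finally show ?thesis .
  qed
  have "dilation_average ?k (\<lambda>s. enn2real (dilation_average ?k w s)) \<xi>
      = (\<integral>\<^sup>+t. \<integral>\<^sup>+u. ennreal (?I t * ?I u * (?k t * ?k (u / t) / t) * ?W u) \<partial>lborel \<partial>lborel)"
    unfolding dilation_average_def[of _ "\<lambda>s. enn2real (dilation_average ?k w s)"]
  proof (rule nn_integral_cong)
    fix t :: real
    show "ennreal (?k t * enn2real (dilation_average ?k w (t * \<xi>))) * indicator {0<..} t
        = (\<integral>\<^sup>+u. ennreal (?I t * ?I u * (?k t * ?k (u / t) / t) * ?W u) \<partial>lborel)"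
    proof (cases "0 < t")
      case True
      have "ennreal (?k t * enn2real (dilation_average ?k w (t * \<xi>)))
          = ennreal (?k t) * (\<integral>\<^sup>+u. ennreal (?I u * ?k (u / t) / t * ?W u) \<partial>lborel)"
        unfolding inner[OF True, symmetric]
        using finite[of "t * \<xi>"] True assms(3) riesz_weight_nonneg[OF True]
        by (simp add: ennreal_mult)
      also have "\<dots> = (\<integral>\<^sup>+u. ennreal (?k t) * ennreal (?I u * ?k (u / t) / t * ?W u) \<partial>lborel)"
        by (subst nn_integral_cmult) auto
      also have "\<dots> = (\<integral>\<^sup>+u. ennreal (?I t * ?I u * (?k t * ?k (u / t) / t) * ?W u) \<partial>lborel)"
        using True riesz_weight_nonneg[OF True]
        by (intro nn_integral_cong) (auto simp: ennreal_mult'[symmetric] ac_simps)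
      finally show ?thesis using True by simp
    qed auto
  qed
  also have "\<dots> = (\<integral>\<^sup>+u. \<integral>\<^sup>+t. ennreal (?I t * ?I u * (?k t * ?k (u / t) / t) * ?W u) \<partial>lborel \<partial>lborel)"
    by (rule lborel_pair.Fubini') measurable
  also have "\<dots> = (\<integral>\<^sup>+u. ennreal (?I u * (2 + \<bar>ln u\<bar>) * ?k u * ?W u) \<partial>lborel)"
  proof (rule nn_integral_cong)
    fix u :: real
    show "(\<integral>\<^sup>+t. ennreal (?I t * ?I u * (?k t * ?k (u / t) / t) * ?W u) \<partial>lborel)
        = ennreal (?I u * (2 + \<bar>ln u\<bar>) * ?k u * ?W u)"
    proof (cases "0 < u")
      case True
      have "(\<integral>\<^sup>+t. ennreal (?I t * ?I u * (?k t * ?k (u / t) / t) * ?W u) \<partial>lborel)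
          = (\<integral>\<^sup>+t. ennreal (?W u) * (ennreal (?k t * ?k (u / t) / t) * indicator {0<..} t) \<partial>lborel)"
        using True by (intro nn_integral_cong)
          (auto simp: ennreal_mult'[OF W0[of u], symmetric] indicator_def mult.commute[of _ "?W u"])
      also have "\<dots> = ennreal (?W u) * ennreal ((2 + \<bar>ln u\<bar>) * ?k u)"
        by (subst nn_integral_cmult) (auto simp: riesz_weight_convolution[OF True])
      also have "\<dots> = ennreal (?W u * ((2 + \<bar>ln u\<bar>) * ?k u))"
        by (rule ennreal_mult'[OF W0, symmetric])
      finally show ?thesis
        using True by (simp add: ac_simps)
    qed auto
  qed
  also have "\<dots> \<le> (\<integral>\<^sup>+u. 2 * ennreal (?I u * log_riesz_weight u * ?W u) \<partial>lborel)"
  proof (rule nn_integral_mono)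
    fix u :: real
    have "?I u * (2 + \<bar>ln u\<bar>) * ?k u * ?W u \<le> 2 * (?I u * log_riesz_weight u * ?W u)"
      using W0[of u] riesz_weight_nonneg[of u] unfolding log_riesz_weight_def
      by (auto simp: indicator_def mult.assoc[symmetric] intro!: mult_right_mono)
    then show "ennreal (?I u * (2 + \<bar>ln u\<bar>) * ?k u * ?W u)
        \<le> 2 * ennreal (?I u * log_riesz_weight u * ?W u)"
      by (metis ennreal_leI ennreal_mult' ennreal_numeral zero_le_numeral)
  qed
  also have "\<dots> = 2 * dilation_average log_riesz_weight w \<xi>"
    unfolding dilation_average_max[OF assms(3)] by (intro nn_integral_cmult) measurable
  finally show ?thesis .
qed

text \<open>The substitution \<open>s = t * \<xi>\<close>; the two logarithms both become \<open>1 + \<bar>ln t\<bar>\<close>.\<close>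

lemma Omega_eq_dilation_average:
  assumes w: "modulus_of_continuity w" and "0 \<le> \<xi>"
  shows "Omega C w \<xi> = ennreal C * dilation_average log_riesz_weight w \<xi>"
proof (cases "\<xi> = 0")
  case True
  then show ?thesis
    using w by (simp add: Omega_def dilation_average_def modulus_of_continuity_def)
next
  case False
  with assms have xi: "0 < \<xi>" by simp
  note [measurable] = borel_measurable_modulus_max[OF w]
  have lg: "ln (exp 1 * x) = 1 + ln x" if "0 < x" for x :: real
    using that by (simp add: ln_mult)
  have near: "(\<integral>\<^sup>+s\<in>{0<..<\<xi>}. ennreal (w s / s * ln (exp 1 * \<xi> / s)) \<partial>lborel)
      = (\<integral>\<^sup>+t. ennreal (indicator {0<..<1} t * log_riesz_weight t * w (max 0 (t * \<xi>))) \<partial>lborel)"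
  proof -
    have "(\<integral>\<^sup>+s\<in>{0<..<\<xi>}. ennreal (w s / s * ln (exp 1 * \<xi> / s)) \<partial>lborel)
        = (\<integral>\<^sup>+s. ennreal (indicator {0<..<\<xi>} s * (w (max 0 s) / s * ln (exp 1 * \<xi> / s))) \<partial>lborel)"
      by (intro nn_integral_cong) (auto simp: indicator_def max_def)
    also have "\<dots> = ennreal \<bar>\<xi>\<bar> * (\<integral>\<^sup>+t. ennreal (indicator {0<..<\<xi>} (0 + \<xi> * t)
        * (w (max 0 (0 + \<xi> * t)) / (0 + \<xi> * t) * ln (exp 1 * \<xi> / (0 + \<xi> * t)))) \<partial>lborel)"
      using xi by (intro nn_integral_real_affine) auto
    also have "\<dots> = (\<integral>\<^sup>+t. ennreal \<bar>\<xi>\<bar> * ennreal (indicator {0<..<\<xi>} (0 + \<xi> * t)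
        * (w (max 0 (0 + \<xi> * t)) / (0 + \<xi> * t) * ln (exp 1 * \<xi> / (0 + \<xi> * t)))) \<partial>lborel)"
      by (subst nn_integral_cmult) auto
    also have "\<dots> = (\<integral>\<^sup>+t. ennreal (indicator {0<..<1} t * log_riesz_weight t * w (max 0 (t * \<xi>))) \<partial>lborel)"
    proof (rule nn_integral_cong)
      fix t :: real
      have "\<xi> * (w (\<xi> * t) / (\<xi> * t) * ln (exp 1 * \<xi> / (\<xi> * t)))
          = log_riesz_weight t * w (t * \<xi>)" if "0 < t" "t < 1"
      proof -
        have "exp 1 * \<xi> / (\<xi> * t) = exp 1 * (1 / t)" using xi by simp
        then have L: "ln (exp 1 * \<xi> / (\<xi> * t)) = 1 + \<bar>ln t\<bar>"
          using that lg[of "1 / t"] by (simp add: ln_div)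
        show ?thesis
          unfolding L using that xi by (simp add: log_riesz_weight_def riesz_weight_def field_simps)
      qed
      then show "ennreal \<bar>\<xi>\<bar> * ennreal (indicator {0<..<\<xi>} (0 + \<xi> * t)
        * (w (max 0 (0 + \<xi> * t)) / (0 + \<xi> * t) * ln (exp 1 * \<xi> / (0 + \<xi> * t))))
        = ennreal (indicator {0<..<1} t * log_riesz_weight t * w (max 0 (t * \<xi>)))"
        using xi by (auto simp: indicator_def ennreal_mult'[symmetric] zero_less_mult_iff max_def
          mult_less_0_iff not_less)
    qed
    finally show ?thesis .
  qed
  have far: "ennreal \<xi> * (\<integral>\<^sup>+s\<in>{\<xi><..}. ennreal (w s / s\<^sup>2 * ln (exp 1 * s / \<xi>)) \<partial>lborel)
      = (\<integral>\<^sup>+t. ennreal (indicator {1<..} t * log_riesz_weight t * w (max 0 (t * \<xi>))) \<partial>lborel)"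
  proof -
    have "ennreal \<xi> * (\<integral>\<^sup>+s\<in>{\<xi><..}. ennreal (w s / s\<^sup>2 * ln (exp 1 * s / \<xi>)) \<partial>lborel)
        = ennreal \<xi> * (\<integral>\<^sup>+s. ennreal (indicator {\<xi><..} s * (w (max 0 s) / s\<^sup>2 * ln (exp 1 * s / \<xi>))) \<partial>lborel)"
      using xi by (intro arg_cong2[where f = "(*)"] nn_integral_cong) (auto simp: indicator_def max_def)
    also have "\<dots> = ennreal \<xi> * (ennreal \<bar>\<xi>\<bar> * (\<integral>\<^sup>+t. ennreal (indicator {\<xi><..} (0 + \<xi> * t)
        * (w (max 0 (0 + \<xi> * t)) / (0 + \<xi> * t)\<^sup>2 * ln (exp 1 * (0 + \<xi> * t) / \<xi>))) \<partial>lborel))"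
      using xi by (intro arg_cong2[where f = "(*)"] nn_integral_real_affine) auto
    also have "\<dots> = (\<integral>\<^sup>+t. ennreal (\<xi> * \<xi>) * ennreal (indicator {\<xi><..} (0 + \<xi> * t)
        * (w (max 0 (0 + \<xi> * t)) / (0 + \<xi> * t)\<^sup>2 * ln (exp 1 * (0 + \<xi> * t) / \<xi>))) \<partial>lborel)"
      using xi by (subst nn_integral_cmult) (auto simp: ennreal_mult mult.assoc)
    also have "\<dots> = (\<integral>\<^sup>+t. ennreal (indicator {1<..} t * log_riesz_weight t * w (max 0 (t * \<xi>))) \<partial>lborel)"
    proof (rule nn_integral_cong)
      fix t :: real
      have "\<xi> * \<xi> * (w (\<xi> * t) / (\<xi> * t)\<^sup>2 * ln (exp 1 * (\<xi> * t) / \<xi>))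
          = log_riesz_weight t * w (t * \<xi>)" if "1 < t"
      proof -
        have "exp 1 * (\<xi> * t) / \<xi> = exp 1 * t" using xi by simp
        then have L: "ln (exp 1 * (\<xi> * t) / \<xi>) = 1 + \<bar>ln t\<bar>"
          using that lg[of t] by simp
        show ?thesis
          unfolding L using that xi by (simp add: log_riesz_weight_def riesz_weight_def field_simps power2_eq_square)
      qed
      moreover have "\<xi> < \<xi> * t \<longleftrightarrow> 1 < t" using xi by simp
      ultimately show "ennreal (\<xi> * \<xi>) * ennreal (indicator {\<xi><..} (0 + \<xi> * t)
        * (w (max 0 (0 + \<xi> * t)) / (0 + \<xi> * t)\<^sup>2 * ln (exp 1 * (0 + \<xi> * t) / \<xi>)))
        = ennreal (indicator {1<..} t * log_riesz_weight t * w (max 0 (t * \<xi>)))"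
        using xi by (cases "1 < t") (auto simp: ennreal_mult'[symmetric] max_absorb2)
    qed
    finally show ?thesis .
  qed
  have "dilation_average log_riesz_weight w \<xi>
      = (\<integral>\<^sup>+t. ennreal (indicator {0<..<1} t * log_riesz_weight t * w (max 0 (t * \<xi>)))
          + ennreal (indicator {1<..} t * log_riesz_weight t * w (max 0 (t * \<xi>))) \<partial>lborel)"
    unfolding dilation_average_max[OF assms(2)]
    by (rule nn_integral_cong_AE)
      (use AE_lborel_singleton[of "1::real"] in eventually_elim, auto simp: indicator_def)
  also have "\<dots> = (\<integral>\<^sup>+t. ennreal (indicator {0<..<1} t * log_riesz_weight t * w (max 0 (t * \<xi>))) \<partial>lborel)
      + (\<integral>\<^sup>+t. ennreal (indicator {1<..} t * log_riesz_weight t * w (max 0 (t * \<xi>))) \<partial>lborel)"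
    by (intro nn_integral_add) measurable
  finally show ?thesis
    unfolding Omega_def near far by simp
qed

section \<open>Radial integrals and affine substitutions\<close>

text \<open>Polar coordinates for radial functions. The image of Lebesgue measure under the norm
  and the measure with density \<open>4 * pi * s\<^sup>2\<close> give every half-line \<open>{..a}\<close> the volume of the ball
  of radius \<open>a\<close>, and half-lines generate the Borel sets.\<close>

lemma nn_integral_radial:
  fixes \<phi> :: "real \<Rightarrow> ennreal"
  assumes [measurable]: "\<phi> \<in> borel_measurable borel"
  shows "(\<integral>\<^sup>+z. \<phi> (norm z) \<partial>(lborel :: (real^3) measure)) =
    (\<integral>\<^sup>+s. ennreal (indicator {0<..} s * (4 * pi * s\<^sup>2)) * \<phi> s \<partial>lborel)"
proof -
  define d where "d s = ennreal (indicator {0<..} s * (4 * pi * s\<^sup>2))" for s :: real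
  have [measurable]: "d \<in> borel_measurable borel" unfolding d_def[abs_def] by measurable
  have ball: "emeasure (distr (lborel :: (real^3) measure) borel norm) {..a}
      = emeasure (density lborel d) {..a}" for a :: real
  proof -
    have "emeasure (distr (lborel :: (real^3) measure) borel norm) {..a}
        = emeasure lborel (cball (0 :: real^3) a)"
      by (subst emeasure_distr) (auto intro!: arg_cong[where f = "emeasure lborel"])
    also have "\<dots> = emeasure (density lborel d) {..a}"
    proof (cases "0 \<le> a")
      case True
      have "emeasure lborel (cball (0 :: real^3) a) = ennreal (4 / 3 * pi * a ^ 3)"
        using True by (simp add: emeasure_cball unit_ball_vol_3)
      also have "\<dots> = ennreal (4 / 3 * pi * a ^ 3 - 4 / 3 * pi * 0 ^ 3)" by simp
      also have "\<dots> = (\<integral>\<^sup>+s. ennreal (4 * pi * s\<^sup>2) * indicator {0..a} s \<partial>lborel)"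
        using True by (intro nn_integral_FTC_Icc[symmetric]) (auto intro!: derivative_eq_intros)
      also have "\<dots> = emeasure (density lborel d) {..a}"
        by (subst emeasure_density) (auto simp: d_def indicator_def intro!: nn_integral_cong)
      finally show ?thesis .
    next
      case False
      then have "emeasure (density lborel d) {..a} = (\<integral>\<^sup>+(s::real). 0 \<partial>lborel)"
        by (subst emeasure_density, simp, simp, intro nn_integral_cong) (auto simp: d_def indicator_def)
      with False show ?thesis by simp
    qed
    finally show ?thesis .
  qed
  have "distr (lborel :: (real^3) measure) borel norm = density lborel d"
  proof (rule measure_eqI_generator_eq[where E = "range atMost" and \<Omega> = UNIV and A = "\<lambda>n. {..real n}"])
    show "Int_stable (range (atMost :: real \<Rightarrow> _))" by (auto simp: Int_stable_def)
    show "(\<Union>n. {..real n}) = UNIV" by (auto intro: real_arch_simple)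
    show "emeasure (distr (lborel :: (real^3) measure) borel norm) {..real n} \<noteq> \<infinity>" for n
    proof -
      have "emeasure (distr (lborel :: (real^3) measure) borel norm) {..real n}
        = emeasure lborel (cball (0 :: real^3) (real n))"
        by (subst emeasure_distr) (auto intro!: arg_cong[where f = "emeasure lborel"])
      then show ?thesis using emeasure_lborel_cball_finite[of "0 :: real^3" "real n"] by auto
    qed
    show "emeasure (distr (lborel :: (real^3) measure) borel norm) X = emeasure (density lborel d) X"
      if "X \<in> range atMost" for X
      using that ball by auto
  qed (auto simp: borel_eq_atMost)
  then have "(\<integral>\<^sup>+s. \<phi> s \<partial>distr (lborel :: (real^3) measure) borel norm)
      = (\<integral>\<^sup>+s. \<phi> s \<partial>density lborel d)" by simp
  then show ?thesis
    by (simp add: nn_integral_distr nn_integral_density d_def)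
qed

lemma nn_integral_reflect:
  fixes x :: "'a::euclidean_space"
  assumes [measurable]: "f \<in> borel_measurable borel"
  shows "(\<integral>\<^sup>+y. f (x - y) \<partial>lborel) = (\<integral>\<^sup>+z. f z \<partial>lborel)"
  by (subst (2) lborel_affine[of "-1" x])
    (simp_all add: nn_integral_density nn_integral_distr one_ennreal_def[symmetric])

lemma integrable_affine_iff:
  fixes f :: "'a::euclidean_space \<Rightarrow> real"
  assumes c: "c \<noteq> 0" and [measurable]: "f \<in> borel_measurable borel"
  shows "integrable lborel (\<lambda>y. f (t + c *\<^sub>R y)) \<longleftrightarrow> integrable lborel f"
  by (subst (2) lborel_affine[OF c, of t])
    (use c in \<open>simp add: integrable_density integrable_distr_eq integrable_mult_right_iff
       integrable_mult_left_iff ennreal_power\<close>)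

lemma integral_affine:
  fixes f :: "'a::euclidean_space \<Rightarrow> real"
  assumes c: "c \<noteq> 0" and [measurable]: "f \<in> borel_measurable borel"
  shows "(LINT z|lborel. f z) = \<bar>c\<bar> ^ DIM('a) * (LINT y|lborel. f (t + c *\<^sub>R y))"
  by (subst lborel_affine[OF c, of t])
    (use c in \<open>simp add: integral_density integral_distr ennreal_power\<close>)

lemma integrable_bounded_support:
  fixes f :: "'a::euclidean_space \<Rightarrow> real"
  assumes "f \<in> borel_measurable borel" "\<And>z. norm z \<le> R \<Longrightarrow> \<bar>f z\<bar> \<le> B" "\<And>z. R < norm z \<Longrightarrow> f z = 0"
  shows "integrable lborel f"
proof (rule Bochner_Integration.integrable_bound)
  show "integrable lborel (\<lambda>z::'a. B * indicator (cball 0 R) z)"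
    using emeasure_lborel_cball_finite[of "0::'a" R] by (intro integrable_mult_right) simp
  show "AE z in lborel. norm (f z) \<le> norm (B * indicator (cball 0 R) z)"
    using assms(2,3) by (intro AE_I2) (force simp: indicator_def not_le)
qed (use assms(1) in simp)

lemma nn_integral_radial_scaled:
  fixes x :: "real^3"
  assumes [measurable]: "\<phi> \<in> borel_measurable borel" and r: "0 < r"
  shows "(\<integral>\<^sup>+y. \<phi> (norm (x - y)) \<partial>lborel)
    = ennreal (4 * pi * r ^ 3) * (\<integral>\<^sup>+t. ennreal (indicator {0<..} t * t\<^sup>2) * \<phi> (t * r) \<partial>lborel)"
proof -
  have "(\<integral>\<^sup>+y. \<phi> (norm (x - y)) \<partial>lborel) = (\<integral>\<^sup>+z. \<phi> (norm z) \<partial>(lborel :: (real^3) measure))"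
    by (rule nn_integral_reflect) measurable
  also have "\<dots> = (\<integral>\<^sup>+s. ennreal (indicator {0<..} s * (4 * pi * s\<^sup>2)) * \<phi> s \<partial>lborel)"
    by (rule nn_integral_radial) measurable
  also have "\<dots> = ennreal \<bar>r\<bar> * (\<integral>\<^sup>+t. ennreal (indicator {0<..} (0 + r * t) * (4 * pi * (0 + r * t)\<^sup>2)) * \<phi> (0 + r * t) \<partial>lborel)"
    using r by (intro nn_integral_real_affine) auto
  also have "\<dots> = (\<integral>\<^sup>+t. ennreal \<bar>r\<bar> * (ennreal (indicator {0<..} (0 + r * t) * (4 * pi * (0 + r * t)\<^sup>2)) * \<phi> (0 + r * t)) \<partial>lborel)"
    by (subst nn_integral_cmult) auto
  also have "\<dots> = (\<integral>\<^sup>+t. ennreal (4 * pi * r ^ 3) * (ennreal (indicator {0<..} t * t\<^sup>2) * \<phi> (t * r)) \<partial>lborel)"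
  proof (rule nn_integral_cong)
    fix t :: real
    have "r * (4 * pi * (r * t)\<^sup>2) = 4 * pi * r ^ 3 * t\<^sup>2"
      by (simp add: power2_eq_square power3_eq_cube)
    then have "ennreal r * ennreal (4 * pi * (r * t)\<^sup>2) = ennreal (4 * pi * r ^ 3) * ennreal (t\<^sup>2)"
      using r by (simp add: ennreal_mult'[symmetric])
    then show "ennreal \<bar>r\<bar> * (ennreal (indicator {0<..} (0 + r * t) * (4 * pi * (0 + r * t)\<^sup>2)) * \<phi> (0 + r * t))
      = ennreal (4 * pi * r ^ 3) * (ennreal (indicator {0<..} t * t\<^sup>2) * \<phi> (t * r))"
      using r by (cases "0 < t") (simp_all add: zero_less_mult_iff mult.assoc[symmetric] mult.commute[of t r])
  qed
  also have "\<dots> = ennreal (4 * pi * r ^ 3) * (\<integral>\<^sup>+t. ennreal (indicator {0<..} t * t\<^sup>2) * \<phi> (t * r) \<partial>lborel)"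
    by (intro nn_integral_cmult) measurable
  finally show ?thesis .
qed

section \<open>The capped Riesz kernel\<close>

text \<open>Freezing the denominator inside the ball of radius \<open>r\<close>, rather than cutting the kernel
  off there, keeps it odd and makes it Lipschitz. The difference to the Riesz kernel is supported
  in that ball and still odd.\<close>

definition capped_riesz_kernel :: "3 \<Rightarrow> real \<Rightarrow> real^3 \<Rightarrow> real" where
  "capped_riesz_kernel j r z = z $ j / (pi\<^sup>2 * max (norm z) r ^ 4)"

lemma borel_measurable_vec_nth3 [measurable]: "(\<lambda>z::real^3. z $ j) \<in> borel_measurable borel"
  by (intro borel_measurable_continuous_onI continuous_intros)

lemma borel_measurable_riesz_kernel [measurable]: "riesz_kernel j \<in> borel_measurable borel"
  unfolding riesz_kernel_def[abs_def] by measurable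

lemma borel_measurable_capped_riesz_kernel [measurable]:
  "capped_riesz_kernel j r \<in> borel_measurable borel"
  unfolding capped_riesz_kernel_def[abs_def] by measurable

lemma capped_riesz_kernel_eq: "r \<le> norm z \<Longrightarrow> capped_riesz_kernel j r z = riesz_kernel j z"
  by (simp add: capped_riesz_kernel_def riesz_kernel_def max_def)

lemma riesz_kernel_minus: "riesz_kernel j (- z) = - riesz_kernel j z"
  by (simp add: riesz_kernel_def)

lemma capped_riesz_kernel_minus: "capped_riesz_kernel j r (- z) = - capped_riesz_kernel j r z"
  by (simp add: capped_riesz_kernel_def)

lemma abs_capped_riesz_kernel_le:
  assumes "0 < r"
  shows "\<bar>capped_riesz_kernel j r z\<bar> \<le> 1 / (pi\<^sup>2 * r ^ 3)"
proof -
  let ?m = "max (norm z) r"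
  have m: "0 < ?m" "r \<le> ?m" using assms by auto
  have "\<bar>z $ j\<bar> \<le> ?m" using component_le_norm_cart[of z j] by linarith
  then have "\<bar>capped_riesz_kernel j r z\<bar> \<le> ?m / (pi\<^sup>2 * ?m ^ 4)"
    unfolding capped_riesz_kernel_def using m by (simp add: abs_mult divide_right_mono)
  also have "\<dots> = 1 / (pi\<^sup>2 * ?m ^ 3)"
    using m by (simp add: field_simps power_eq_if del: max_less_iff_conj)
  also have "\<dots> \<le> 1 / (pi\<^sup>2 * r ^ 3)"
    using m assms by (intro divide_left_mono mult_left_mono power_mono) auto
  finally show ?thesis .
qed

lemma abs_riesz_kernel_minus_capped_le:
  assumes "norm z \<le> r"
  shows "\<bar>riesz_kernel j z - capped_riesz_kernel j r z\<bar> \<le> 1 / (pi\<^sup>2 * norm z ^ 3)"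
proof (cases "z = 0")
  case False
  then have z: "0 < norm z" and r: "0 < r" using assms by (auto intro: less_le_trans[of _ "norm z"])
  have "riesz_kernel j z - capped_riesz_kernel j r z = z $ j / pi\<^sup>2 * (1 / norm z ^ 4 - 1 / r ^ 4)"
    using assms by (simp add: riesz_kernel_def capped_riesz_kernel_def max_def right_diff_distrib)
  moreover have "0 \<le> 1 / norm z ^ 4 - 1 / r ^ 4"
    using z r assms by (auto intro!: divide_left_mono power_mono)
  ultimately have "\<bar>riesz_kernel j z - capped_riesz_kernel j r z\<bar>
      = \<bar>z $ j\<bar> / pi\<^sup>2 * (1 / norm z ^ 4 - 1 / r ^ 4)"
    by (simp only: abs_mult abs_of_nonneg abs_divide) simp
  also have "\<dots> \<le> \<bar>z $ j\<bar> / pi\<^sup>2 * (1 / norm z ^ 4)"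
    using r by (intro mult_left_mono) auto
  also have "\<dots> \<le> norm z / pi\<^sup>2 * (1 / norm z ^ 4)"
    by (intro mult_right_mono divide_right_mono component_le_norm_cart) auto
  also have "\<dots> = 1 / (pi\<^sup>2 * norm z ^ 3)"
    using z by (simp add: field_simps power_eq_if)
  finally show ?thesis .
qed (simp add: riesz_kernel_def capped_riesz_kernel_def)

text \<open>Put \<open>m = max (norm a) r\<close> and \<open>n = max (norm b) r\<close>. Both are \<open>1\<close>-Lipschitz functions of
  the point, so \<open>\<bar>n - m\<bar> \<le> norm (a - b)\<close>, and \<open>q\<close> measures the comparability \<open>m \<le> q * n\<close>. The
  difference of the denominators is controlled through the factorisation of \<open>n ^ 4 - m ^ 4\<close>.\<close>

lemma capped_riesz_kernel_lipschitz:
  assumes r: "0 < r" and q: "norm (a - b) \<le> (q - 1) * r"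
  shows "\<bar>capped_riesz_kernel j r a - capped_riesz_kernel j r b\<bar>
    \<le> (1 + (1 + q) * (1 + q\<^sup>2)) * norm (a - b) / (pi\<^sup>2 * max (norm a) r ^ 4)"
proof -
  define m n d where "m = max (norm a) r" and "n = max (norm b) r" and "d = norm (a - b)"
  have d0: "0 \<le> d" by (simp add: d_def)
  have m: "0 < m" and n: "0 < n" "r \<le> n" using r by (auto simp: m_def n_def)
  have nm: "\<bar>n - m\<bar> \<le> d"
    unfolding m_def n_def d_def using norm_triangle_ineq3[of a b] by (auto simp: max_def)
  have q1: "1 \<le> q" using q r d0 unfolding d_def[symmetric]
    by (metis diff_ge_0_iff_ge order_trans zero_le_mult_iff not_less)
  have "(q - 1) * r \<le> (q - 1) * n" using q1 n by (intro mult_left_mono) auto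
  then have mq: "m \<le> q * n" using nm q unfolding d_def[symmetric] by (simp add: algebra_simps)
  have aj: "\<bar>a $ j - b $ j\<bar> \<le> d" using component_le_norm_cart[of "a - b" j] by (simp add: d_def)
  have bj: "\<bar>b $ j\<bar> \<le> n" using component_le_norm_cart[of b j] by (auto simp: n_def)
  have "\<bar>n ^ 4 - m ^ 4\<bar> = \<bar>n - m\<bar> * ((n + m) * (n\<^sup>2 + m\<^sup>2))"
  proof -
    have "n ^ 4 - m ^ 4 = (n - m) * ((n + m) * (n\<^sup>2 + m\<^sup>2))"
      by (simp add: algebra_simps power2_eq_square power4_eq_xxxx)
    moreover have "0 \<le> (n + m) * (n\<^sup>2 + m\<^sup>2)" using m n by simp
    ultimately show ?thesis by (simp only: abs_mult[of "n - m"] abs_of_nonneg)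
  qed
  also have "\<dots> \<le> d * (((1 + q) * n) * ((1 + q\<^sup>2) * n\<^sup>2))"
  proof (intro mult_mono nm)
    show "n + m \<le> (1 + q) * n" using mq by (simp add: algebra_simps)
    have "m\<^sup>2 \<le> (q * n)\<^sup>2" using mq m by (intro power_mono) auto
    then show "n\<^sup>2 + m\<^sup>2 \<le> (1 + q\<^sup>2) * n\<^sup>2" by (simp add: algebra_simps power_mult_distrib)
  qed (use m n d0 q1 in auto)
  also have "\<dots> = (1 + q) * (1 + q\<^sup>2) * d * n ^ 3"
    by (simp add: power2_eq_square power3_eq_cube)
  finally have pw: "\<bar>n ^ 4 - m ^ 4\<bar> \<le> (1 + q) * (1 + q\<^sup>2) * d * n ^ 3" .
  have "\<bar>a $ j / m ^ 4 - b $ j / n ^ 4\<bar>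
      = \<bar>(a $ j - b $ j) / m ^ 4 + b $ j * (n ^ 4 - m ^ 4) / (m ^ 4 * n ^ 4)\<bar>"
    using m n by (simp add: field_simps)
  also have "\<dots> \<le> \<bar>a $ j - b $ j\<bar> / m ^ 4 + \<bar>b $ j\<bar> * \<bar>n ^ 4 - m ^ 4\<bar> / (m ^ 4 * n ^ 4)"
    by (rule order_trans[OF abs_triangle_ineq]) (simp add: abs_mult)
  also have "\<dots> \<le> d / m ^ 4 + n * ((1 + q) * (1 + q\<^sup>2) * d * n ^ 3) / (m ^ 4 * n ^ 4)"
    using m n by (intro add_mono divide_right_mono mult_mono aj bj pw) auto
  also have "\<dots> = (1 + (1 + q) * (1 + q\<^sup>2)) * d / m ^ 4"
    using m n by (simp add: field_simps power_eq_if)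
  finally have main: "\<bar>a $ j / m ^ 4 - b $ j / n ^ 4\<bar> \<le> (1 + (1 + q) * (1 + q\<^sup>2)) * d / m ^ 4" .
  have "capped_riesz_kernel j r a - capped_riesz_kernel j r b
      = (a $ j / m ^ 4 - b $ j / n ^ 4) / pi\<^sup>2"
    by (simp add: capped_riesz_kernel_def m_def n_def diff_divide_distrib mult.commute)
  then have "\<bar>capped_riesz_kernel j r a - capped_riesz_kernel j r b\<bar>
      = \<bar>a $ j / m ^ 4 - b $ j / n ^ 4\<bar> / pi\<^sup>2" by simp
  also have "\<dots> \<le> (1 + (1 + q) * (1 + q\<^sup>2)) * d / m ^ 4 / pi\<^sup>2"
    using main by (intro divide_right_mono) auto
  finally show ?thesis by (simp add: m_def d_def mult.commute)
qed

lemma nn_integral_far: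
  fixes x :: "real^3"
  assumes [measurable]: "W \<in> borel_measurable borel" and W0: "\<And>s. 0 \<le> W s" and r: "0 < r"
  shows "(\<integral>\<^sup>+y. ennreal (W (norm (x - y)) / max (norm (x - y)) r ^ 4) \<partial>lborel)
    = ennreal (4 * pi / r) * (\<integral>\<^sup>+t. ennreal (indicator {0<..} t * (t\<^sup>2 / max 1 t ^ 4) * W (t * r)) \<partial>lborel)"
proof -
  have "(\<integral>\<^sup>+y. ennreal (W (norm (x - y)) / max (norm (x - y)) r ^ 4) \<partial>lborel)
    = ennreal (4 * pi * r ^ 3) * (\<integral>\<^sup>+t. ennreal (indicator {0<..} t * t\<^sup>2)
        * ennreal (W (t * r) / max (t * r) r ^ 4) \<partial>lborel)"
    using r by (intro nn_integral_radial_scaled) measurable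
  also have "\<dots> = (\<integral>\<^sup>+t. ennreal (4 * pi * r ^ 3) * (ennreal (indicator {0<..} t * t\<^sup>2)
        * ennreal (W (t * r) / max (t * r) r ^ 4)) \<partial>lborel)"
    by (intro nn_integral_cmult[symmetric]) measurable
  also have "\<dots> = (\<integral>\<^sup>+t. ennreal (4 * pi / r)
      * ennreal (indicator {0<..} t * (t\<^sup>2 / max 1 t ^ 4) * W (t * r)) \<partial>lborel)"
  proof (rule nn_integral_cong)
    fix t :: real
    have mx: "max (t * r) r = r * max 1 t" using r by (simp add: max_def)
    have "4 * pi * r ^ 3 * (t\<^sup>2 * (W (t * r) / max (t * r) r ^ 4))
        = 4 * pi / r * (t\<^sup>2 / max 1 t ^ 4 * W (t * r))"
      unfolding mx using r by (simp add: power_mult_distrib field_simps power_eq_if)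
    then show "ennreal (4 * pi * r ^ 3) * (ennreal (indicator {0<..} t * t\<^sup>2)
        * ennreal (W (t * r) / max (t * r) r ^ 4))
      = ennreal (4 * pi / r) * ennreal (indicator {0<..} t * (t\<^sup>2 / max 1 t ^ 4) * W (t * r))"
      using r W0 by (cases "0 < t") (simp_all add: ennreal_mult'[symmetric])
  qed
  also have "\<dots> = ennreal (4 * pi / r)
      * (\<integral>\<^sup>+t. ennreal (indicator {0<..} t * (t\<^sup>2 / max 1 t ^ 4) * W (t * r)) \<partial>lborel)"
    by (intro nn_integral_cmult) measurable
  finally show ?thesis .
qed

text \<open>The weight \<open>t\<^sup>2 / max 1 t ^ 4\<close> from polar coordinates equals \<open>riesz_weight t\<close> for
  \<open>t \<ge> 1\<close>; for \<open>0 < t < 1\<close> it is smaller.\<close>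

lemma nn_integral_far_modulus_le:
  fixes x :: "real^3"
  assumes w: "modulus_of_continuity w" and r: "0 < r"
  shows "(\<integral>\<^sup>+y. ennreal (w (norm (x - y)) / max (norm (x - y)) r ^ 4) \<partial>lborel)
    \<le> ennreal (4 * pi / r) * dilation_average riesz_weight w r"
proof -
  note [measurable] = borel_measurable_modulus_max[OF w]
  have "(\<integral>\<^sup>+y. ennreal (w (norm (x - y)) / max (norm (x - y)) r ^ 4) \<partial>lborel)
      = (\<integral>\<^sup>+y. ennreal (w (max 0 (norm (x - y))) / max (norm (x - y)) r ^ 4) \<partial>lborel)"
    by (simp add: max_absorb2)
  also have "\<dots> = ennreal (4 * pi / r)
      * (\<integral>\<^sup>+t. ennreal (indicator {0<..} t * (t\<^sup>2 / max 1 t ^ 4) * w (max 0 (t * r))) \<partial>lborel)"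
    using r by (intro nn_integral_far) (auto intro: modulus_nonneg[OF w])
  also have "\<dots> \<le> ennreal (4 * pi / r) * dilation_average riesz_weight w r"
    unfolding dilation_average_max[OF less_imp_le[OF r]]
  proof (intro mult_left_mono nn_integral_mono ennreal_leI)
    fix t :: real
    have "t\<^sup>2 / max 1 t ^ 4 \<le> riesz_weight t" if "0 < t"
    proof (cases "t \<le> 1")
      case True
      have "t ^ 3 \<le> 1" using that True by (intro power_le_one) auto
      then show ?thesis using True that
        by (simp add: riesz_weight_def max_def pos_le_divide_eq power_eq_if)
    next
      case False
      then show ?thesis
        by (simp add: riesz_weight_def max_def field_simps power_eq_if)
    qed
    then show "indicator {0<..} t * (t\<^sup>2 / max 1 t ^ 4) * w (max 0 (t * r))
        \<le> indicator {0<..} t * riesz_weight t * w (max 0 (t * r))"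
      by (intro mult_right_mono modulus_nonneg[OF w]) (auto simp: indicator_def)
  qed auto
  finally show ?thesis .
qed

lemma nn_integral_near_modulus_le:
  fixes x :: "real^3"
  assumes w: "modulus_of_continuity w" and r: "0 < r"
  shows "(\<integral>\<^sup>+y. ennreal (indicator {..<r} (norm (x - y)) * (w (norm (x - y)) / norm (x - y) ^ 3)) \<partial>lborel)
    \<le> ennreal (4 * pi) * dilation_average riesz_weight w r"
proof -
  note [measurable] = borel_measurable_modulus_max[OF w]
  have W0: "0 \<le> w (max 0 s)" for s by (simp add: modulus_nonneg[OF w])
  have "(\<integral>\<^sup>+y. ennreal (indicator {..<r} (norm (x - y)) * (w (norm (x - y)) / norm (x - y) ^ 3)) \<partial>lborel)
      = (\<integral>\<^sup>+y. ennreal (indicator {..<r} (norm (x - y)) * (w (max 0 (norm (x - y))) / norm (x - y) ^ 3)) \<partial>lborel)"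
    by (simp add: max_absorb2)
  also have "\<dots> = ennreal (4 * pi * r ^ 3) * (\<integral>\<^sup>+t. ennreal (indicator {0<..} t * t\<^sup>2)
      * ennreal (indicator {..<r} (t * r) * (w (max 0 (t * r)) / (t * r) ^ 3)) \<partial>lborel)"
    using r by (intro nn_integral_radial_scaled) measurable
  also have "\<dots> = (\<integral>\<^sup>+t. ennreal (4 * pi * r ^ 3) * (ennreal (indicator {0<..} t * t\<^sup>2)
      * ennreal (indicator {..<r} (t * r) * (w (max 0 (t * r)) / (t * r) ^ 3))) \<partial>lborel)"
    by (intro nn_integral_cmult[symmetric]) measurable
  also have "\<dots> \<le> (\<integral>\<^sup>+t. ennreal (4 * pi)
      * ennreal (indicator {0<..} t * riesz_weight t * w (max 0 (t * r))) \<partial>lborel)"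
  proof (rule nn_integral_mono)
    fix t :: real
    show "ennreal (4 * pi * r ^ 3) * (ennreal (indicator {0<..} t * t\<^sup>2)
      * ennreal (indicator {..<r} (t * r) * (w (max 0 (t * r)) / (t * r) ^ 3)))
      \<le> ennreal (4 * pi) * ennreal (indicator {0<..} t * riesz_weight t * w (max 0 (t * r)))"
    proof (cases "0 < t \<and> t < 1")
      case True
      then have "4 * pi * r ^ 3 * (t\<^sup>2 * (w (max 0 (t * r)) / (t * r) ^ 3))
          = 4 * pi * (riesz_weight t * w (max 0 (t * r)))"
        using r by (simp add: riesz_weight_def power_mult_distrib field_simps power_eq_if)
      moreover have "t * r < r" using True r by simp
      ultimately show ?thesis
        using True r W0 by (simp add: ennreal_mult'[symmetric])
    next
      case False
      then have "t \<le> 0 \<or> \<not> t * r < r" using r by auto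
      then show ?thesis by auto
    qed
  qed
  also have "\<dots> = ennreal (4 * pi) * dilation_average riesz_weight w r"
    unfolding dilation_average_max[OF less_imp_le[OF r]] by (intro nn_integral_cmult) measurable
  finally show ?thesis .
qed

lemma integrable_far:
  fixes x :: "real^3"
  assumes r: "0 < r"
  shows "integrable lborel (\<lambda>y. 1 / max (norm (x - y)) r ^ 4)"
proof -
  have "(\<integral>\<^sup>+t. ennreal (indicator {0<..} t * (t\<^sup>2 / max 1 t ^ 4) * 1) \<partial>lborel)
      \<le> (\<integral>\<^sup>+t. indicator {0..1} t + ennreal (1 / t\<^sup>2) * indicator {1..} t \<partial>lborel)"
  proof (rule nn_integral_mono)
    fix t :: real
    consider "t \<le> 0" | "0 < t" "t \<le> 1" | "1 < t" by linarith
    then show "ennreal (indicator {0<..} t * (t\<^sup>2 / max 1 t ^ 4) * 1)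
        \<le> indicator {0..1} t + ennreal (1 / t\<^sup>2) * indicator {1..} t"
    proof cases
      case 2
      then have "ennreal (t\<^sup>2) \<le> 1" using power_le_one[of t 2] by (simp add: ennreal_le_1)
      moreover have "ennreal (t\<^sup>2) \<le> a \<Longrightarrow> ennreal (t\<^sup>2) \<le> a + b" for a b
        by (simp add: add_increasing2)
      ultimately show ?thesis using 2 by (auto simp: max_def)
    next
      case 3
      then have "t\<^sup>2 / max 1 t ^ 4 = 1 / t\<^sup>2" by (simp add: max_def field_simps power_eq_if)
      then show ?thesis using 3 by simp
    qed auto
  qed
  also have "\<dots> = (\<integral>\<^sup>+t. indicator {0..1} (t::real) \<partial>lborel)
      + (\<integral>\<^sup>+t. ennreal (1 / t\<^sup>2) * indicator {1::real..} t \<partial>lborel)"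
    by (intro nn_integral_add) measurable
  also have "(\<integral>\<^sup>+t. ennreal (1 / t\<^sup>2) * indicator {1::real..} t \<partial>lborel) = ennreal (0 - (- 1 / 1))"
  proof (rule nn_integral_FTC_atLeast[where F = "\<lambda>t. - 1 / t"])
    show "((\<lambda>t::real. - 1 / t) \<longlongrightarrow> 0) at_top"
      by (intro tendsto_divide_0[OF tendsto_const] filterlim_at_top_imp_at_infinity filterlim_ident)
    show "((\<lambda>t. - 1 / t) has_real_derivative 1 / t\<^sup>2) (at t)" if "1 \<le> t" for t :: real
      using that by (auto intro!: derivative_eq_intros simp: field_simps power2_eq_square)
  qed auto
  also have "(\<integral>\<^sup>+t. indicator {0..1} (t::real) \<partial>lborel) + ennreal (0 - (- 1 / 1)) < \<infinity>"
    by simp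
  finally have "(\<integral>\<^sup>+t. ennreal (indicator {0<..} t * (t\<^sup>2 / max 1 t ^ 4) * 1) \<partial>lborel) < \<infinity>" .
  then have "(\<integral>\<^sup>+y. ennreal (1 / max (norm (x - y)) r ^ 4) \<partial>lborel) < \<infinity>"
    using nn_integral_far[of "\<lambda>_. 1" r x] r by (simp add: ennreal_mult_less_top)
  then show ?thesis
    using r by (intro integrableI_nonneg) auto
qed

lemma integrable_capped_riesz_kernel_diff:
  assumes r: "0 < r"
  shows "integrable lborel (\<lambda>y. capped_riesz_kernel j r (x - y) - capped_riesz_kernel j r (x' - y))"
proof (rule Bochner_Integration.integrable_bound)
  define q where "q = 1 + norm (x - x') / r"
  have q: "norm ((x - y) - (x' - y)) \<le> (q - 1) * r" for y
    using r by (simp add: q_def)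
  have nonneg: "0 \<le> (1 + (1 + q) * (1 + q\<^sup>2)) * norm (x - x')"
    using r by (simp add: q_def)
  show "integrable lborel (\<lambda>y. (1 + (1 + q) * (1 + q\<^sup>2)) * norm (x - x') / pi\<^sup>2
      * (1 / max (norm (x - y)) r ^ 4))"
    by (intro integrable_mult_right integrable_far r)
  show "AE y in lborel. norm (capped_riesz_kernel j r (x - y) - capped_riesz_kernel j r (x' - y))
      \<le> norm ((1 + (1 + q) * (1 + q\<^sup>2)) * norm (x - x') / pi\<^sup>2 * (1 / max (norm (x - y)) r ^ 4))"
  proof (intro AE_I2)
    fix y
    have "\<bar>capped_riesz_kernel j r (x - y) - capped_riesz_kernel j r (x' - y)\<bar>
        \<le> (1 + (1 + q) * (1 + q\<^sup>2)) * norm (x - x') / (pi\<^sup>2 * max (norm (x - y)) r ^ 4)"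
      using capped_riesz_kernel_lipschitz[OF r q[of y], of j] by simp
    then show "norm (capped_riesz_kernel j r (x - y) - capped_riesz_kernel j r (x' - y))
        \<le> norm ((1 + (1 + q) * (1 + q\<^sup>2)) * norm (x - x') / pi\<^sup>2 * (1 / max (norm (x - y)) r ^ 4))"
      using nonneg by (simp add: abs_of_nonneg)
  qed
qed measurable

lemma integrable_capped_riesz_kernel_recap:
  assumes "0 < r" "0 < s"
  shows "integrable lborel (\<lambda>z. capped_riesz_kernel j r z - capped_riesz_kernel j s z)"
proof (rule integrable_bounded_support[where R = "max r s"])
  show "\<bar>capped_riesz_kernel j r z - capped_riesz_kernel j s z\<bar>
      \<le> 1 / (pi\<^sup>2 * r ^ 3) + 1 / (pi\<^sup>2 * s ^ 3)" for z
    using abs_capped_riesz_kernel_le[OF assms(1), of j z] abs_capped_riesz_kernel_le[OF assms(2), of j z]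
    by linarith
qed (auto simp: capped_riesz_kernel_eq)

text \<open>The kernel itself is not integrable, so translation invariance does not apply to its
  two halves separately, and oddness does not help either, because the difference is symmetric
  about the midpoint of \<open>x\<close> and \<open>x'\<close>. Let \<open>G s h\<close> be the integral for cap radius \<open>s\<close> and
  displacement \<open>h\<close>. Passing through the intermediate point \<open>h\<close> gives \<open>G r (2 h) = 2 * G r h\<close>.
  Rescaling by the factor \<open>2\<close> gives \<open>G r (2 h) = G (r / 2) h\<close>, because
  \<open>8 * capped_riesz_kernel j r (2 z) = capped_riesz_kernel j (r / 2) z\<close>. Finally
  \<open>G (r / 2) h = G r h\<close>, because two capped kernels differ by a function of bounded support, to
  which translation invariance does apply. Hence \<open>G r h = 2 * G r h\<close>.\<close>

lemma integral_capped_riesz_kernel_diff: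
  assumes r: "0 < r"
  shows "(LINT y|lborel. capped_riesz_kernel j r (x - y) - capped_riesz_kernel j r (x' - y)) = 0"
proof -
  define K where "K = capped_riesz_kernel j"
  have [measurable]: "K s \<in> borel_measurable borel" for s by (simp add: K_def)
  have int: "integrable lborel (\<lambda>y. K s (x - y) - K s (x' - y))" if "0 < s" for s x x'
    unfolding K_def using that by (rule integrable_capped_riesz_kernel_diff)
  define G where "G s h = (LINT y|lborel. K s (h - y) - K s (- y))" for s h
  have shift: "(LINT y|lborel. K s (x - y) - K s (x' - y)) = G s (x - x')" for s x x'
    unfolding G_def by (subst integral_affine[of 1 _ x']) (simp_all add: algebra_simps)
  have additive: "G r (2 *\<^sub>R h) = 2 * G r h" for h
  proof -
    have "G r (2 *\<^sub>R h) = (LINT y|lborel. (K r (2 *\<^sub>R h - y) - K r (h - y)) + (K r (h - y) - K r (0 - y)))"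
      by (simp add: G_def)
    also have "\<dots> = (LINT y|lborel. K r (2 *\<^sub>R h - y) - K r (h - y)) + (LINT y|lborel. K r (h - y) - K r (0 - y))"
      by (intro Bochner_Integration.integral_add int r)
    also have "\<dots> = 2 * G r h"
      unfolding shift by (simp add: scaleR_2)
    finally show ?thesis .
  qed
  have scaling: "G r (2 *\<^sub>R h) = G (r / 2) h" for h
  proof -
    have K2: "8 * K r (2 *\<^sub>R z) = K (r / 2) z" for z
    proof -
      have "max (norm (2 *\<^sub>R z)) r = 2 * max (norm z) (r / 2)" by (auto simp: max_def)
      then show ?thesis by (simp add: K_def capped_riesz_kernel_def power_mult_distrib)
    qed
    have "G r (2 *\<^sub>R h) = 8 * (LINT y|lborel. K r (2 *\<^sub>R h - 2 *\<^sub>R y) - K r (- (2 *\<^sub>R y)))"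
      unfolding G_def by (subst integral_affine[of 2 _ 0]) simp_all
    also have "\<dots> = (LINT y|lborel. 8 * K r (2 *\<^sub>R (h - y)) - 8 * K r (2 *\<^sub>R (- y)))"
      by (simp add: algebra_simps flip: integral_mult_right_zero)
    also have "\<dots> = G (r / 2) h" unfolding K2 G_def ..
    finally show ?thesis .
  qed
  have recap: "G (r / 2) h = G r h" for h
  proof -
    define E where "E z = K (r / 2) z - K r z" for z
    have [measurable]: "E \<in> borel_measurable borel" unfolding E_def[abs_def] by measurable
    have E: "integrable lborel E"
      unfolding E_def K_def using r by (intro integrable_capped_riesz_kernel_recap) auto
    have E': "integrable lborel (\<lambda>y. E (h - y))" for h
      using integrable_affine_iff[of "-1" E h] E by simp
    have "G (r / 2) h - G r h
        = (LINT y|lborel. (K (r / 2) (h - y) - K (r / 2) (0 - y)) - (K r (h - y) - K r (0 - y)))"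
      unfolding G_def using int[of "r / 2" h 0] int[of r h 0] r
      by (subst Bochner_Integration.integral_diff[symmetric]) auto
    also have "\<dots> = (LINT y|lborel. E (h - y) - E (0 - y))"
      by (simp add: E_def algebra_simps)
    also have "\<dots> = (LINT y|lborel. E (h - y)) - (LINT y|lborel. E (0 - y))"
      by (intro Bochner_Integration.integral_diff E')
    also have "\<dots> = 0"
      using integral_affine[of "-1" E h] integral_affine[of "-1" E 0] by simp
    finally show ?thesis by simp
  qed
  have "G r h = 0" for h using additive[of h] scaling[of h] recap[of h] by simp
  then show ?thesis using shift[of r x x'] by (simp add: K_def)
qed

section \<open>Increments of a Riesz transform\<close>

lemma tendsto_truncated_integral:
  fixes h :: "'a::euclidean_space \<Rightarrow> real"
  assumes h: "integrable lborel h"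
  shows "((\<lambda>\<epsilon>. LINT y|lborel. indicator {y. \<epsilon> < norm (x - y)} y * h y) \<longlongrightarrow> (LINT y|lborel. h y)) (at_right 0)"
proof (rule tendsto_at_right_sequentially[where b = 1])
  fix S :: "nat \<Rightarrow> real"
  assume S: "\<And>n. 0 < S n" "S \<longlonglongrightarrow> 0"
  have [measurable]: "h \<in> borel_measurable borel" using h by simp
  show "(\<lambda>n. LINT y|lborel. indicator {y. S n < norm (x - y)} y * h y) \<longlonglongrightarrow> (LINT y|lborel. h y)"
  proof (rule integral_dominated_convergence[where w = "\<lambda>y. \<bar>h y\<bar>"])
    show "AE y in lborel. (\<lambda>n. indicator {y. S n < norm (x - y)} y * h y) \<longlonglongrightarrow> h y"
      using AE_lborel_singleton[of x]
    proof eventually_elim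
      case (elim y)
      then have "\<forall>\<^sub>F n in sequentially. S n < norm (x - y)"
        using order_tendstoD(2)[OF S(2), of "norm (x - y)"] by simp
      then have "\<forall>\<^sub>F n in sequentially. indicator {y. S n < norm (x - y)} y * h y = h y"
        by eventually_elim simp
      then show ?case by (rule tendsto_eventually)
    qed
  qed (use h in \<open>auto simp: indicator_def\<close>)
qed simp

lemma integral_odd_eq_0:
  fixes E :: "'a::euclidean_space \<Rightarrow> real"
  assumes [measurable]: "E \<in> borel_measurable borel" and "\<And>z. E (- z) = - E z"
  shows "(LINT y|lborel. E (x - y)) = 0"
proof -
  have "(LINT y|lborel. E (x - y)) = (LINT z|lborel. E z)"
    using integral_affine[of "-1" E x] by simp
  moreover have "(LINT z|lborel. E z) = - (LINT z|lborel. E z)"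
    using integral_affine[of "-1" E 0] assms by simp
  ultimately show ?thesis by simp
qed

text \<open>The situation in which one Riesz transform of \<open>f\<close> can be estimated. It reproduces
  itself with a new modulus, so that the results apply to iterated transforms.\<close>

locale riesz_controlled =
  fixes w :: "real \<Rightarrow> real" and f :: "real^3 \<Rightarrow> real"
  assumes modulus: "modulus_of_continuity w"
    and increment: "\<bar>f x - f y\<bar> \<le> w (norm (x - y))"
    and average_finite_1: "dilation_average riesz_weight w 1 < \<infinity>"
begin

lemma average_finite: "0 \<le> \<xi> \<Longrightarrow> dilation_average riesz_weight w \<xi> < \<infinity>"
  using dilation_average_finite[OF modulus borel_measurable_riesz_weight riesz_weight_nonneg _ average_finite_1]
  by simp

lemma ennreal_mult_average:
  "0 \<le> p \<Longrightarrow> 0 \<le> q \<Longrightarrow> 0 \<le> \<xi> \<Longrightarrow> ennreal p * (ennreal q * dilation_average riesz_weight w \<xi>)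
    = ennreal (p * q * enn2real (dilation_average riesz_weight w \<xi>))"
  using average_finite[of \<xi>] by (simp add: ennreal_mult mult.assoc)

lemma continuous_on_f: "continuous_on UNIV f"
proof -
  have "f \<midarrow>x\<rightarrow> f x" for x
  proof -
    have "((\<lambda>y. w (max 0 (norm (y - x)))) \<longlongrightarrow> w (max 0 (norm (x - x)))) (at x)"
      using continuous_on_modulus_max[OF modulus]
      by (intro isCont_tendsto_compose[of _ "\<lambda>t. w (max 0 t)"] tendsto_intros)
        (simp add: continuous_on_eq_continuous_at)
    then have lim: "((\<lambda>y. w (norm (y - x))) \<longlongrightarrow> 0) (at x)"
      using modulus by (simp add: max_absorb2 modulus_of_continuity_def)
    have "((\<lambda>y. f y - f x) \<longlongrightarrow> 0) (at x)"
      by (rule Lim_null_comparison[OF _ lim]) (simp add: increment)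
    then show ?thesis by (simp add: LIM_zero_iff)
  qed
  then show ?thesis by (simp add: continuous_on_eq_continuous_at isCont_def)
qed

lemma borel_measurable_f [measurable]: "f \<in> borel_measurable borel"
  by (rule borel_measurable_continuous_onI[OF continuous_on_f])

text \<open>For every \<open>r > 0\<close> the integrand of the transform splits into a part near \<open>x\<close>, in which
  oddness allows \<open>f y\<close> to be replaced by \<open>f y - f x\<close>, and an outer part with the capped kernel. The
  correction at infinity depends neither on \<open>x\<close> nor on \<open>r\<close>, so it cancels in increments.\<close>

definition near_part :: "3 \<Rightarrow> real \<Rightarrow> real^3 \<Rightarrow> real^3 \<Rightarrow> real" where
  "near_part j r x y = (riesz_kernel j (x - y) - capped_riesz_kernel j r (x - y)) * (f y - f x)"

definition correction :: "3 \<Rightarrow> real^3 \<Rightarrow> real" where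
  "correction j y = (if tail_integrable f \<or> norm y \<le> 1 then 0 else riesz_kernel j (- y))"

definition outer_part :: "3 \<Rightarrow> real \<Rightarrow> real^3 \<Rightarrow> real^3 \<Rightarrow> real" where
  "outer_part j r x y = (capped_riesz_kernel j r (x - y) - correction j y) * f y"

lemma borel_measurable_correction [measurable]: "correction j \<in> borel_measurable borel"
  unfolding correction_def[abs_def] by measurable

lemma borel_measurable_parts [measurable]:
  "near_part j r x \<in> borel_measurable borel" "outer_part j r x \<in> borel_measurable borel"
  unfolding near_part_def[abs_def] outer_part_def[abs_def] by measurable

text \<open>The kernel is at most \<open>1 / (pi\<^sup>2 * norm (x - y) ^ 3)\<close> and vanishes outside the ball of
  radius \<open>r\<close>, so polar coordinates leave the part \<open>t < 1\<close> of the average.\<close>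

lemma near_part_estimate:
  assumes r: "0 < r"
  shows "integrable lborel (near_part j r x)"
    and "\<bar>LINT y|lborel. near_part j r x y\<bar> \<le> 4 / pi * enn2real (dilation_average riesz_weight w r)"
proof -
  have le: "ennreal \<bar>near_part j r x y\<bar>
      \<le> ennreal (1 / pi\<^sup>2) * ennreal (indicator {..<r} (norm (x - y)) * (w (norm (x - y)) / norm (x - y) ^ 3))" for y
  proof (cases "norm (x - y) < r")
    case True
    have "\<bar>near_part j r x y\<bar> \<le> 1 / (pi\<^sup>2 * norm (x - y) ^ 3) * w (norm (x - y))"
      unfolding near_part_def abs_mult using True increment[of y x]
      by (intro mult_mono abs_riesz_kernel_minus_capped_le) (auto simp: norm_minus_commute)
    then show ?thesis using True by (simp add: ennreal_mult'[symmetric] ennreal_leI)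
  qed (simp add: near_part_def capped_riesz_kernel_eq)
  have "(\<integral>\<^sup>+y. ennreal \<bar>near_part j r x y\<bar> \<partial>lborel) \<le> (\<integral>\<^sup>+y. ennreal (1 / pi\<^sup>2)
      * ennreal (indicator {..<r} (norm (x - y)) * (w (max 0 (norm (x - y))) / norm (x - y) ^ 3)) \<partial>lborel)"
    using le by (intro nn_integral_mono) (simp add: max_absorb2)
  also have "\<dots> = ennreal (1 / pi\<^sup>2) * (\<integral>\<^sup>+y. ennreal (indicator {..<r} (norm (x - y))
      * (w (max 0 (norm (x - y))) / norm (x - y) ^ 3)) \<partial>lborel)"
    by (intro nn_integral_cmult) (use borel_measurable_modulus_max[OF modulus] in measurable)
  also have "\<dots> \<le> ennreal (1 / pi\<^sup>2) * (ennreal (4 * pi) * dilation_average riesz_weight w r)"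
    using nn_integral_near_modulus_le[OF modulus r, of x] by (intro mult_left_mono) (auto simp: max_absorb2)
  also have "\<dots> = ennreal (4 / pi * enn2real (dilation_average riesz_weight w r))"
    using r by (subst ennreal_mult_average) (auto simp: power2_eq_square)
  finally have bound: "(\<integral>\<^sup>+y. ennreal \<bar>near_part j r x y\<bar> \<partial>lborel)
      \<le> ennreal (4 / pi * enn2real (dilation_average riesz_weight w r))" .
  show int: "integrable lborel (near_part j r x)"
    using bound by (intro integrableI_bounded) (auto intro: le_less_trans)
  show "\<bar>LINT y|lborel. near_part j r x y\<bar> \<le> 4 / pi * enn2real (dilation_average riesz_weight w r)"
    using order_trans[OF integral_norm_bound_ennreal[OF int] bound[folded real_norm_def]]
    by (simp add: ennreal_le_iff)
qed

text \<open>The Lipschitz bound for the capped kernel gains one power of decay, which makes the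
  integral against \<open>w (norm (x - y))\<close> converge. If the displacement equals the cap radius, then
  \<open>q = 2\<close> and the Lipschitz constant is \<open>1 + 3 * 5 = 16\<close>.\<close>

lemma far_difference_estimate:
  assumes r: "0 < r"
  shows "integrable lborel (\<lambda>y. (capped_riesz_kernel j r (x - y) - capped_riesz_kernel j r (x' - y)) * (f y - f x))"
    and "norm (x - x') = r \<Longrightarrow>
      \<bar>LINT y|lborel. (capped_riesz_kernel j r (x - y) - capped_riesz_kernel j r (x' - y)) * (f y - f x)\<bar>
      \<le> 64 / pi * enn2real (dilation_average riesz_weight w r)"
proof -
  let ?D = "\<lambda>y. (capped_riesz_kernel j r (x - y) - capped_riesz_kernel j r (x' - y)) * (f y - f x)"
  define q where "q = 1 + norm (x - x') / r"
  define c where "c = (1 + (1 + q) * (1 + q\<^sup>2)) * norm (x - x') / pi\<^sup>2"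
  have q: "norm ((x - y) - (x' - y)) \<le> (q - 1) * r" for y
    using r by (simp add: q_def)
  have c0: "0 \<le> c" using r by (simp add: c_def q_def)
  have le: "ennreal \<bar>?D y\<bar> \<le> ennreal c * ennreal (w (max 0 (norm (x - y))) / max (norm (x - y)) r ^ 4)" for y
  proof -
    have "\<bar>?D y\<bar> \<le> (1 + (1 + q) * (1 + q\<^sup>2)) * norm ((x - y) - (x' - y)) / (pi\<^sup>2 * max (norm (x - y)) r ^ 4)
        * w (norm (x - y))"
      unfolding abs_mult using increment[of y x] r
      by (intro mult_mono capped_riesz_kernel_lipschitz[OF r q]) (auto simp: norm_minus_commute q_def)
    also have "\<dots> = c * (w (max 0 (norm (x - y))) / max (norm (x - y)) r ^ 4)"
      by (simp add: c_def max_absorb2)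
    finally show ?thesis
      using c0 by (simp add: ennreal_mult'[symmetric] ennreal_leI)
  qed
  have "(\<integral>\<^sup>+y. ennreal \<bar>?D y\<bar> \<partial>lborel)
      \<le> (\<integral>\<^sup>+y. ennreal c * ennreal (w (max 0 (norm (x - y))) / max (norm (x - y)) r ^ 4) \<partial>lborel)"
    using le by (intro nn_integral_mono)
  also have "\<dots> = ennreal c * (\<integral>\<^sup>+y. ennreal (w (max 0 (norm (x - y))) / max (norm (x - y)) r ^ 4) \<partial>lborel)"
    by (intro nn_integral_cmult) (use borel_measurable_modulus_max[OF modulus] in measurable)
  also have "\<dots> \<le> ennreal c * (ennreal (4 * pi / r) * dilation_average riesz_weight w r)"
    using nn_integral_far_modulus_le[OF modulus r, of x] by (intro mult_left_mono) (auto simp: max_absorb2)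
  also have "\<dots> = ennreal (c * (4 * pi / r) * enn2real (dilation_average riesz_weight w r))"
    using r c0 by (intro ennreal_mult_average) auto
  finally have bound: "(\<integral>\<^sup>+y. ennreal \<bar>?D y\<bar> \<partial>lborel)
      \<le> ennreal (c * (4 * pi / r) * enn2real (dilation_average riesz_weight w r))" .
  show int: "integrable lborel ?D"
    using bound by (intro integrableI_bounded) (auto intro: le_less_trans)
  assume "norm (x - x') = r"
  then have "c = 16 * r / pi\<^sup>2" using r by (simp add: c_def q_def power2_eq_square)
  then have "c * (4 * pi / r) = 64 / pi" using r by (simp add: power2_eq_square)
  then show "\<bar>LINT y|lborel. ?D y\<bar> \<le> 64 / pi * enn2real (dilation_average riesz_weight w r)"
    using order_trans[OF integral_norm_bound_ennreal[OF int] bound[folded real_norm_def]]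
    by (simp add: ennreal_le_iff)
qed

text \<open>With the correction, the kernel at infinity is a difference of two translates of the
  capped kernel, up to a part of bounded support. The constant part \<open>f x\<close> and the increment
  \<open>f y - f x\<close> are then both integrable against it. If \<open>f\<close> is \<open>tail_integrable\<close>, then the correction
  term alone is integrable, so omitting it does no harm.\<close>

lemma integrable_outer_part:
  assumes r: "0 < r"
  shows "integrable lborel (outer_part j r x)"
proof -
  define tail where "tail y = (if norm y \<le> 1 then 0 else riesz_kernel j (- y))" for y
  have [measurable]: "tail \<in> borel_measurable borel"
    unfolding tail_def[abs_def] by measurable
  have tail_le: "\<bar>tail y\<bar> \<le> 1 / pi\<^sup>2" for y
    using abs_capped_riesz_kernel_le[of 1 j "- y"]
    by (auto simp: tail_def capped_riesz_kernel_eq)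
  obtain B where B: "\<And>y. norm y \<le> max 1 r \<Longrightarrow> \<bar>f y\<bar> \<le> B"
  proof -
    have "compact (f ` cball 0 (max 1 r))"
      by (intro compact_continuous_image continuous_on_subset[OF continuous_on_f]) auto
    then have "bounded (f ` cball 0 (max 1 r))" by (rule compact_imp_bounded)
    then obtain B where "\<forall>v \<in> f ` cball 0 (max 1 r). norm v \<le> B"
      unfolding bounded_iff by blast
    then show ?thesis by (intro that[of B]) simp
  qed
  \<comment> \<open>beyond \<open>max 1 r\<close> the capped kernel at the origin and the correction agree\<close>
  have central: "integrable lborel (\<lambda>y. (capped_riesz_kernel j r (0 - y) - tail y) * f y)"
  proof (rule integrable_bounded_support[where R = "max 1 r"])
    fix y :: "real^3"
    assume "norm y \<le> max 1 r"
    moreover have "\<bar>capped_riesz_kernel j r (0 - y) - tail y\<bar> \<le> 1 / (pi\<^sup>2 * r ^ 3) + 1 / pi\<^sup>2"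
      using abs_capped_riesz_kernel_le[OF r, of j "0 - y"] tail_le[of y] by linarith
    ultimately show "\<bar>(capped_riesz_kernel j r (0 - y) - tail y) * f y\<bar>
        \<le> (1 / (pi\<^sup>2 * r ^ 3) + 1 / pi\<^sup>2) * B"
      unfolding abs_mult using B r by (intro mult_mono) auto
  qed (auto simp: tail_def capped_riesz_kernel_eq)
  have "integrable lborel (\<lambda>y.
      (capped_riesz_kernel j r (x - y) - capped_riesz_kernel j r (0 - y)) * (f y - f x)
      + (capped_riesz_kernel j r (x - y) - capped_riesz_kernel j r (0 - y)) * f x
      + (capped_riesz_kernel j r (0 - y) - tail y) * f y)"
    by (intro Bochner_Integration.integrable_add far_difference_estimate(1) central integrable_mult_left
      integrable_capped_riesz_kernel_diff r)
  then have corrected: "integrable lborel (\<lambda>y. (capped_riesz_kernel j r (x - y) - tail y) * f y)"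
    by (rule back_subst[of "integrable lborel"]) (auto simp: algebra_simps)
  show ?thesis
  proof (cases "tail_integrable f")
    case False
    then have "correction j = tail" by (auto simp: correction_def tail_def)
    then show ?thesis
      using corrected by (simp add: outer_part_def[abs_def])
  next
    case True
    then have "integrable lebesgue (\<lambda>y. indicator {y. 1 < norm y} y * (f y / norm y ^ 3))"
      by (simp add: tail_integrable_def set_integrable_def)
    then have decay: "integrable lborel (\<lambda>y. indicator {y. 1 < norm y} y * (f y / norm y ^ 3))"
      by (subst (asm) integrable_completion) measurable
    have "integrable lborel (\<lambda>y. tail y * f y)"
    proof (rule Bochner_Integration.integrable_bound[OF decay])
      have "norm (tail y * f y) \<le> norm (indicator {y. 1 < norm y} y * (f y / norm y ^ 3))" for y
      proof (cases "1 < norm y")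
        case True
        have "\<bar>y $ j\<bar> / (pi\<^sup>2 * norm y ^ 4) \<le> norm y / (1 * norm y ^ 4)"
          using component_le_norm_cart[of y j] True pi_gt3
          by (intro frac_le mult_right_mono) (auto simp: one_le_power)
        also have "\<dots> = 1 / norm y ^ 3"
          using True by (simp add: field_simps power_eq_if)
        finally have "\<bar>tail y\<bar> \<le> 1 / norm y ^ 3"
          using True by (simp add: tail_def riesz_kernel_def abs_mult)
        then have "\<bar>tail y\<bar> * \<bar>f y\<bar> \<le> 1 / norm y ^ 3 * \<bar>f y\<bar>" by (rule mult_right_mono) simp
        then show ?thesis using True by (simp add: abs_mult)
      qed (simp add: tail_def)
      then show "AE y in lborel. norm (tail y * f y)
          \<le> norm (indicator {y. 1 < norm y} y * (f y / norm y ^ 3))" by simp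
    qed measurable
    with corrected have "integrable lborel (\<lambda>y. (capped_riesz_kernel j r (x - y) - tail y) * f y + tail y * f y)"
      by (rule Bochner_Integration.integrable_add)
    with True show ?thesis
      by (simp add: outer_part_def[abs_def] correction_def algebra_simps)
  qed
qed

lemma riesz_integrand_split:
  "riesz_integrand j f x y = near_part j r x y + outer_part j r x y
    + (riesz_kernel j (x - y) - capped_riesz_kernel j r (x - y)) * f x"
  by (simp add: riesz_integrand_def near_part_def outer_part_def correction_def algebra_simps)

lemma borel_measurable_riesz_integrand [measurable]: "riesz_integrand j f x \<in> borel_measurable borel"
  unfolding riesz_integrand_def[abs_def] by measurable

text \<open>The three-term splitting of the integrand contains the constant \<open>f x\<close> times an odd
  function of bounded support, and its truncated integral vanishes.\<close>

lemma riesz_trunc_split: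
  assumes r: "0 < r" and e: "0 < \<epsilon>"
  shows "set_integrable lebesgue {y. \<epsilon> < norm (x - y)} (riesz_integrand j f x)"
    and "riesz_trunc j f \<epsilon> x = (LINT y|lborel. indicator {y. \<epsilon> < norm (x - y)} y * near_part j r x y)
      + (LINT y|lborel. indicator {y. \<epsilon> < norm (x - y)} y * outer_part j r x y)"
proof -
  let ?I = "\<lambda>y. indicator {y. \<epsilon> < norm (x - y)} y :: real"
  \<comment> \<open>the odd remainder of the splitting, which multiplies the constant \<open>f x\<close>\<close>
  define E where "E z = indicator {\<epsilon><..} (norm z) * (riesz_kernel j z - capped_riesz_kernel j r z)" for z
  have [measurable]: "E \<in> borel_measurable borel" unfolding E_def[abs_def] by measurable
  have "integrable lborel E"
  proof (rule integrable_bounded_support[where R = r])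
    fix z :: "real^3"
    assume "norm z \<le> r"
    have "\<bar>riesz_kernel j z\<bar> \<le> 1 / (pi\<^sup>2 * \<epsilon> ^ 3)" if "\<epsilon> < norm z"
      using abs_capped_riesz_kernel_le[OF e, of j z] that by (simp add: capped_riesz_kernel_eq)
    then show "\<bar>E z\<bar> \<le> 1 / (pi\<^sup>2 * \<epsilon> ^ 3) + 1 / (pi\<^sup>2 * r ^ 3)"
      using abs_capped_riesz_kernel_le[OF r, of j z] r e
      by (auto simp: E_def indicator_def intro: order_trans[OF abs_triangle_ineq4 add_mono])
  qed (auto simp: E_def capped_riesz_kernel_eq)
  then have E_int: "integrable lborel (\<lambda>y. E (x - y))"
    using integrable_affine_iff[of "-1" E x] by simp
  have E_0: "(LINT y|lborel. E (x - y)) = 0"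
    by (rule integral_odd_eq_0) (auto simp: E_def riesz_kernel_minus capped_riesz_kernel_minus algebra_simps)
  have near: "integrable lborel (\<lambda>y. ?I y * near_part j r x y)"
    by (rule Bochner_Integration.integrable_bound[OF near_part_estimate(1)[OF r, of j x]]) (auto simp: indicator_def)
  have outer: "integrable lborel (\<lambda>y. ?I y * outer_part j r x y)"
    by (rule Bochner_Integration.integrable_bound[OF integrable_outer_part[OF r, of j x]]) (auto simp: indicator_def)
  have split: "?I y *\<^sub>R riesz_integrand j f x y
      = ?I y * near_part j r x y + ?I y * outer_part j r x y + E (x - y) * f x" for y
    unfolding riesz_integrand_split[of j x y r] by (simp add: E_def indicator_def)
  have int: "integrable lborel (\<lambda>y. ?I y *\<^sub>R riesz_integrand j f x y)"
    unfolding split by (intro Bochner_Integration.integrable_add near outer integrable_mult_left E_int)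
  have meas: "(\<lambda>y. ?I y *\<^sub>R riesz_integrand j f x y) \<in> borel_measurable lborel"
    by measurable
  show "set_integrable lebesgue {y. \<epsilon> < norm (x - y)} (riesz_integrand j f x)"
    unfolding set_integrable_def using int integrable_completion[OF meas] by simp
  have "riesz_trunc j f \<epsilon> x = (LINT y|lborel. ?I y *\<^sub>R riesz_integrand j f x y)"
    unfolding riesz_trunc_def set_lebesgue_integral_def by (rule integral_completion[OF meas])
  also have "\<dots> = (LINT y|lborel. ?I y * near_part j r x y) + (LINT y|lborel. ?I y * outer_part j r x y)
      + (LINT y|lborel. E (x - y) * f x)"
    unfolding split using near outer E_int by simp
  finally show "riesz_trunc j f \<epsilon> x = (LINT y|lborel. ?I y * near_part j r x y)
      + (LINT y|lborel. ?I y * outer_part j r x y)"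
    using E_0 by simp
qed

lemma tendsto_riesz_trunc:
  assumes r: "0 < r"
  shows "((\<lambda>\<epsilon>. riesz_trunc j f \<epsilon> x)
    \<longlongrightarrow> (LINT y|lborel. near_part j r x y) + (LINT y|lborel. outer_part j r x y)) (at_right 0)"
proof -
  have "((\<lambda>\<epsilon>. (LINT y|lborel. indicator {y. \<epsilon> < norm (x - y)} y * near_part j r x y)
      + (LINT y|lborel. indicator {y. \<epsilon> < norm (x - y)} y * outer_part j r x y))
    \<longlongrightarrow> (LINT y|lborel. near_part j r x y) + (LINT y|lborel. outer_part j r x y)) (at_right 0)"
    by (intro tendsto_add tendsto_truncated_integral near_part_estimate(1) integrable_outer_part r)
  then show ?thesis
    by (rule Lim_transform_eventually)
      (use riesz_trunc_split(2)[OF r] in \<open>auto simp: eventually_at_right_less intro: eventually_mono[OF eventually_at_right_less]\<close>)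
qed

lemma riesz_exists: "riesz_exists j f"
  unfolding riesz_exists_def
  using riesz_trunc_split(1)[OF zero_less_one] tendsto_riesz_trunc[OF zero_less_one] by blast

text \<open>The left-hand side does not involve \<open>r\<close>, so the radius can be adapted to the increment
  under consideration.\<close>

lemma riesz_eq:
  assumes "0 < r"
  shows "riesz j f x = (LINT y|lborel. near_part j r x y) + (LINT y|lborel. outer_part j r x y)"
  unfolding riesz_def by (rule tendsto_Lim[OF _ tendsto_riesz_trunc[OF assms]]) simp

text \<open>The radius is taken to be \<open>norm (x - x')\<close>. The two near parts contribute \<open>4 / pi\<close> each
  and the difference of the outer parts contributes \<open>64 / pi\<close>. In the latter, \<open>f y\<close> may be replaced
  by \<open>f y - f x\<close>, since the kernel difference has integral zero.\<close>

lemma riesz_increment: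
  "\<bar>riesz j f x - riesz j f x'\<bar> \<le> 72 / pi * enn2real (dilation_average riesz_weight w (norm (x - x')))"
proof (cases "x = x'")
  case False
  define r where "r = norm (x - x')"
  have r: "0 < r" using False by (simp add: r_def)
  let ?D = "\<lambda>y. capped_riesz_kernel j r (x - y) - capped_riesz_kernel j r (x' - y)"
  have "(LINT y|lborel. outer_part j r x y) - (LINT y|lborel. outer_part j r x' y)
      = (LINT y|lborel. outer_part j r x y - outer_part j r x' y)"
    by (intro Bochner_Integration.integral_diff[symmetric] integrable_outer_part r)
  also have "\<dots> = (LINT y|lborel. ?D y * (f y - f x) + ?D y * f x)"
    by (simp add: outer_part_def algebra_simps)
  also have "\<dots> = (LINT y|lborel. ?D y * (f y - f x)) + (LINT y|lborel. ?D y * f x)"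
    by (intro Bochner_Integration.integral_add far_difference_estimate(1) integrable_mult_left
      integrable_capped_riesz_kernel_diff r)
  also have "(LINT y|lborel. ?D y * f x) = 0"
    using integral_capped_riesz_kernel_diff[OF r] by simp
  finally have split: "riesz j f x - riesz j f x' = (LINT y|lborel. near_part j r x y)
      - (LINT y|lborel. near_part j r x' y) + (LINT y|lborel. ?D y * (f y - f x))"
    unfolding riesz_eq[OF r] by simp
  define Q where "Q = enn2real (dilation_average riesz_weight w r) / pi"
  have "\<bar>LINT y|lborel. near_part j r x y\<bar> \<le> 4 * Q" "\<bar>LINT y|lborel. near_part j r x' y\<bar> \<le> 4 * Q"
    "\<bar>LINT y|lborel. ?D y * (f y - f x)\<bar> \<le> 64 * Q"
    using near_part_estimate(2)[OF r, of j x] near_part_estimate(2)[OF r, of j x']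
      far_difference_estimate(2)[OF r r_def[symmetric], of j]
    by (simp_all add: Q_def)
  then have "\<bar>riesz j f x - riesz j f x'\<bar> \<le> 72 * Q"
    unfolding split by linarith
  then show ?thesis by (simp add: Q_def r_def)
qed simp

end

section \<open>Iterated transforms and the velocity\<close>

context riesz_controlled
begin

text \<open>By the increment bound, the transform of \<open>f\<close> is controlled by the average of \<open>w\<close>. This
  average is again a modulus of continuity, and its own average is finite by the bound on iterated
  averages. So the increment bound applies a second time.\<close>

lemma riesz_controlled_riesz:
  assumes fin: "dilation_average log_riesz_weight w 1 < \<infinity>"
  shows "riesz_controlled (\<lambda>\<xi>. 72 / pi * enn2real (dilation_average riesz_weight w \<xi>)) (riesz j f)"
    and "ennreal \<bar>riesz i (riesz j f) x - riesz i (riesz j f) y\<bar>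
      \<le> ennreal (2 * (72 / pi)\<^sup>2) * dilation_average log_riesz_weight w (norm (x - y))"
proof -
  define v where "v \<xi> = enn2real (dilation_average riesz_weight w \<xi>)" for \<xi>
  have v: "modulus_of_continuity v"
    unfolding v_def
    by (intro modulus_dilation_average modulus borel_measurable_riesz_weight riesz_weight_nonneg
      average_finite_1)
  have avg_v: "dilation_average riesz_weight (\<lambda>\<xi>. 72 / pi * v \<xi>) \<xi>
      \<le> ennreal (72 / pi) * (2 * dilation_average log_riesz_weight w \<xi>)" if "0 \<le> \<xi>" for \<xi>
    using that dilation_average_riesz_riesz_le[OF modulus average_finite_1 that] unfolding v_def[symmetric]
    by (subst dilation_average_cmult[OF v]) (auto intro: mult_left_mono)
  show *: "riesz_controlled (\<lambda>\<xi>. 72 / pi * enn2real (dilation_average riesz_weight w \<xi>)) (riesz j f)"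
    unfolding v_def[symmetric]
  proof
    show "modulus_of_continuity (\<lambda>\<xi>. 72 / pi * v \<xi>)"
      using v by (rule modulus_cmult) simp
    show "\<bar>riesz j f x - riesz j f y\<bar> \<le> 72 / pi * v (norm (x - y))" for x y
      unfolding v_def by (rule riesz_increment)
    have "ennreal (72 / pi) * (2 * dilation_average log_riesz_weight w 1) < \<infinity>"
      using fin by (simp add: ennreal_mult_less_top)
    then show "dilation_average riesz_weight (\<lambda>\<xi>. 72 / pi * v \<xi>) 1 < \<infinity>"
      using avg_v[of 1] by (auto intro: le_less_trans)
  qed
  interpret R: riesz_controlled "\<lambda>\<xi>. 72 / pi * v \<xi>" "riesz j f"
    using * unfolding v_def .
  let ?\<xi> = "norm (x - y)"
  have "ennreal \<bar>riesz i (riesz j f) x - riesz i (riesz j f) y\<bar>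
      \<le> ennreal (72 / pi * enn2real (dilation_average riesz_weight (\<lambda>\<xi>. 72 / pi * v \<xi>) ?\<xi>))"
    by (intro ennreal_leI R.riesz_increment)
  also have "\<dots> = ennreal (72 / pi) * dilation_average riesz_weight (\<lambda>\<xi>. 72 / pi * v \<xi>) ?\<xi>"
    using R.average_finite[of ?\<xi>] by (simp add: ennreal_mult del: times_divide_eq_left)
  also have "\<dots> \<le> ennreal (72 / pi) * (ennreal (72 / pi) * (2 * dilation_average log_riesz_weight w ?\<xi>))"
    by (intro mult_left_mono avg_v) auto
  also have "\<dots> = ennreal (2 * (72 / pi)\<^sup>2) * dilation_average log_riesz_weight w ?\<xi>"
  proof -
    have "ennreal (2 * (72 / pi)\<^sup>2) = 2 * (ennreal (72 / pi) * ennreal (72 / pi))"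
      by (simp only: power2_eq_square ennreal_mult' ennreal_numeral zero_le_numeral
        zero_le_mult_iff ennreal_mult pi_ge_zero zero_le_divide_iff simp_thms)
    then show ?thesis by (simp add: ac_simps)
  qed
  finally show "ennreal \<bar>riesz i (riesz j f) x - riesz i (riesz j f) y\<bar>
      \<le> ennreal (2 * (72 / pi)\<^sup>2) * dilation_average log_riesz_weight w ?\<xi>" .
qed

text \<open>Each velocity component is a sum of at most two second-order transforms; four of them
  occur in total.\<close>

lemma velocity_controlled:
  assumes fin: "dilation_average log_riesz_weight w 1 < \<infinity>"
  shows "velocity_exists f"
    and "ennreal (norm (velocity f x - velocity f y)) \<le> Omega (8 * (72 / pi)\<^sup>2) w (norm (x - y))"
proof -
  show "velocity_exists f"
    unfolding velocity_exists_def
    using riesz_exists riesz_controlled.riesz_exists[OF riesz_controlled_riesz(1)[OF fin]] by blast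
  define d where "d i j = \<bar>riesz i (riesz j f) x - riesz i (riesz j f) y\<bar>" for i j
  define P where "P = ennreal (2 * (72 / pi)\<^sup>2) * dilation_average log_riesz_weight w (norm (x - y))"
  have d: "ennreal (d i j) \<le> P" for i j
    unfolding d_def P_def by (rule riesz_controlled_riesz(2)[OF fin])
  have "norm (velocity f x - velocity f y) \<le> (\<Sum>i\<in>UNIV. \<bar>(velocity f x - velocity f y) $ i\<bar>)"
    by (rule norm_le_l1_cart)
  also have "\<dots> \<le> d 1 3 + d 2 3 + d 1 1 + d 2 2"
    unfolding d_def by (simp add: sum_3 velocity_def)
  finally have "ennreal (norm (velocity f x - velocity f y))
      \<le> ennreal (d 1 3 + d 2 3 + d 1 1 + d 2 2)"
    by (rule ennreal_leI)
  also have "\<dots> = ennreal (d 1 3) + ennreal (d 2 3) + ennreal (d 1 1) + ennreal (d 2 2)"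
    by (simp add: d_def)
  also have "\<dots> \<le> P + P + P + P" by (intro add_mono d)
  also have "\<dots> = 4 * P" by (simp add: mult_2[symmetric] add.assoc mult.assoc[symmetric] flip: mult_2)
  also have "\<dots> = ennreal (8 * (72 / pi)\<^sup>2) * dilation_average log_riesz_weight w (norm (x - y))"
  proof -
    have "ennreal (8 * (72 / pi)\<^sup>2) = ennreal (4 * (2 * (72 / pi)\<^sup>2))" by simp
    also have "\<dots> = 4 * ennreal (2 * (72 / pi)\<^sup>2)"
      by (subst ennreal_mult) auto
    finally show ?thesis by (simp only: P_def mult.assoc)
  qed
  finally show "ennreal (norm (velocity f x - velocity f y)) \<le> Omega (8 * (72 / pi)\<^sup>2) w (norm (x - y))"
    by (simp add: Omega_eq_dilation_average[OF modulus])
qed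

end

theorem lemma4p1:
  shows "\<exists>C::real. C > 0 \<and>
    (\<forall>(\<omega>::real \<Rightarrow> real) (\<theta>::real^3 \<Rightarrow> real).
       modulus_of_continuity \<omega> \<longrightarrow> has_modulus \<theta> (\<lambda>s. ennreal (\<omega> s)) \<longrightarrow>
         has_modulus (velocity \<theta>) (Omega C \<omega>) \<and>
         ((\<forall>\<xi>>0. Omega C \<omega> \<xi> < \<infinity>) \<longrightarrow>
            velocity_exists \<theta> \<and> modulus_of_continuity (\<lambda>\<xi>. enn2real (Omega C \<omega> \<xi>))))"
proof -
  define C :: real where "C = 8 * (72 / pi)\<^sup>2"
  have C: "0 < C" by (simp add: C_def)
  have "has_modulus (velocity \<theta>) (Omega C \<omega>) \<and>
      ((\<forall>\<xi>>0. Omega C \<omega> \<xi> < \<infinity>) \<longrightarrow>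
        velocity_exists \<theta> \<and> modulus_of_continuity (\<lambda>\<xi>. enn2real (Omega C \<omega> \<xi>)))"
    if w: "modulus_of_continuity \<omega>" and mod: "has_modulus \<theta> (\<lambda>s. ennreal (\<omega> s))"
    for \<omega> :: "real \<Rightarrow> real" and \<theta> :: "real^3 \<Rightarrow> real"
  proof -
    have Omega: "Omega C \<omega> \<xi> = ennreal C * dilation_average log_riesz_weight \<omega> \<xi>" if "0 \<le> \<xi>" for \<xi>
      using w that by (rule Omega_eq_dilation_average)
    have fin: "dilation_average log_riesz_weight \<omega> 1 < \<infinity>" if "0 < \<xi>" "Omega C \<omega> \<xi> < \<infinity>" for \<xi>
    proof (rule dilation_average_finite[OF w borel_measurable_log_riesz_weight log_riesz_weight_nonneg that(1)])
      show "dilation_average log_riesz_weight \<omega> \<xi> < \<infinity>"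
        using that C by (auto simp: Omega ennreal_mult_less_top)
    qed auto
    have controlled: "riesz_controlled \<omega> \<theta>" if "dilation_average log_riesz_weight \<omega> 1 < \<infinity>"
    proof
      show "\<bar>\<theta> x - \<theta> y\<bar> \<le> \<omega> (norm (x - y))" for x y
      proof -
        have "ennreal \<bar>\<theta> x - \<theta> y\<bar> \<le> ennreal (\<omega> (norm (x - y)))"
          using mod by (simp add: has_modulus_def)
        then show ?thesis
          using modulus_nonneg[OF w, of "norm (x - y)"] by (subst (asm) ennreal_le_iff) auto
      qed
      have "dilation_average riesz_weight \<omega> 1 \<le> dilation_average log_riesz_weight \<omega> 1"
        unfolding dilation_average_def
      proof (rule nn_integral_mono)
        fix t :: real
        have "riesz_weight t * \<omega> (t * 1) \<le> log_riesz_weight t * \<omega> (t * 1)" if "0 < t"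
          using that by (intro mult_right_mono riesz_weight_le_log modulus_nonneg[OF w]) auto
        then show "ennreal (riesz_weight t * \<omega> (t * 1)) * indicator {0<..} t
            \<le> ennreal (log_riesz_weight t * \<omega> (t * 1)) * indicator {0<..} t"
          by (cases "0 < t") (simp_all add: ennreal_leI)
      qed
      with that show "dilation_average riesz_weight \<omega> 1 < \<infinity>" by (rule le_less_trans[rotated])
    qed (rule w)
    have "ennreal (norm (velocity \<theta> x - velocity \<theta> y)) \<le> Omega C \<omega> (norm (x - y))" for x y
    \<comment> \<open>finiteness of \<open>Omega\<close> at one positive argument entails it at all of them,
      so either the bound is vacuous at this pair or the estimates for the transforms apply\<close>
    proof (cases "x = y \<or> Omega C \<omega> (norm (x - y)) = \<infinity>")
      case False
      then have "dilation_average log_riesz_weight \<omega> 1 < \<infinity>"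
        by (intro fin[of "norm (x - y)"]) (auto simp: less_top)
      then show ?thesis
        unfolding C_def using riesz_controlled.velocity_controlled(2)[OF controlled] by blast
    qed auto
    moreover have "velocity_exists \<theta> \<and> modulus_of_continuity (\<lambda>\<xi>. enn2real (Omega C \<omega> \<xi>))"
      if "\<forall>\<xi>>0. Omega C \<omega> \<xi> < \<infinity>"
    proof
      have fin1: "dilation_average log_riesz_weight \<omega> 1 < \<infinity>"
        using that fin[of 1] by simp
      show "velocity_exists \<theta>"
        using riesz_controlled.velocity_controlled(1)[OF controlled] fin1 by blast
      have "modulus_of_continuity (\<lambda>\<xi>. C * enn2real (dilation_average log_riesz_weight \<omega> \<xi>))"
        using C by (intro modulus_cmult modulus_dilation_average w borel_measurable_log_riesz_weight
          log_riesz_weight_nonneg fin1) auto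
      then show "modulus_of_continuity (\<lambda>\<xi>. enn2real (Omega C \<omega> \<xi>))"
        by (rule modulus_cong) (use C in \<open>simp add: Omega enn2real_mult\<close>)
    qed
    ultimately show ?thesis by (simp add: has_modulus_def)
  qed
  with C show ?thesis by blast
qed

end
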